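(* Let $(W,S)$ and $(W',S')$ be Coxeter systems. Let $I_\bullet=[I_0,\dots,I_d]$ be an expression in $(W,S)$, let $p$ be an $(I_0,I_d)$-coset in $W$, and let $J\subset S'$ be finitary. Let $I_\bullet^{(+J)}$ and $p^{(+J)}$ be the associated expression and double coset in $(W\times W',S\sqcup S')$. Then: (1) $\overline{p^{(+J)}}=\overline p.w_J$ and $\underline{p^{(+J)}}=\underline p$. (2) $\ell^+(p^{(+J)})=\ell^+(p)$ and $\ell^-(p^{(+J)})=\ell^-(p)$. (3) $\ell^+(I_\bullet^{(+J)})=\ell^+(I_\bullet)$ and $\ell^-(I_\bullet^{(+J)})=\ell^-(I_\bullet)$. (4) $I_\bullet$ expresses $p$ if and only if $I_\bullet^{(+J)}$ expresses $p^{(+J)}$. (5) $I_\bullet$ is reduced if and only if $I_\bullet^{(+J)}$ is reduced.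
   Context: For a Coxeter system $(W,S)$ with identity $e$, length $\ell_W$ and Bruhat order: $W_I$ is the parabolic subgroup generated by $I\subset S$; $I$ is finitary if $W_I$ is finite, and then $w_I$ is its longest element and $\ell(I):=\ell_W(w_I)$. For finitary $I,J$, a $(J,I)$-coset is a double coset $p\in W_J\backslash W/W_I$ (the pair $(J,I)$ is part of the data), with unique Bruhat-maximal element $\overline p$ and Bruhat-minimal element $\underline p$. The notation $w=x.y$ means $w=xy$ and $\ell_W(w)=\ell_W(x)+\ell_W(y)$. An expression is a sequence $[I_0,\dots,I_d]$ of finitary subsets of $S$, consecutive ones differing by adding or removing exactly one element of $S$. Its forward path is the sequence $p_0,\dots,p_d$ where $p_i$ is an $(I_0,I_i)$-coset, $e\in p_0$; if $I_i\subset I_{i+1}$, $p_{i+1}$ is the $(I_0,I_{i+1})$-coset containing $p_i$; if $I_i\supset I_{i+1}$, $p_{i+1}$ is the $(I_0,I_{i+1})$-coset containing $\overline{p_i}$. It expresses $p_d$. Put $K_i=I_0\cap\underline{p_i}I_i\underline{p_i}^{-1}$. The expression is reduced if for every $i$ with $I_i\subset I_{i+1}$ one has $\underline{p_i}=\underline{p_{i+1}}$ and $K_i=K_{i+1}$. Lengths: for a $(J,I)$-coset $p$, $\ell^+(p)=\ell_W(\overline p)-\ell(J)$ and $\ell^-(p)=\ell_W(\underline p)+\ell(J)-\ell(J\cap\underline pI\underline p^{-1})$. For an expression, $\ell^+(I_\bullet)=\sum(\ell(I_i)-\ell(I_{i-1}))$ over $1\le i\le d$ with $I_{i-1}\subset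 I_i$, and $\ell^-(I_\bullet)=\sum(\ell(I_{i-1})-\ell(I_i))$ over $1\le i\le d$ with $I_{i-1}\supset I_i$. Product construction: $I_\bullet^{(+J)}=[I_0\sqcup J,I_1\sqcup J,\dots,I_d\sqcup J]$ in the Coxeter system $(W\times W',S\sqcup S')$, and $p^{(+J)}$ is the $(I_0\sqcup J,I_d\sqcup J)$-coset in $W\times W'$ containing $\overline p.w_J$ (with $W,W'$ viewed as subgroups of $W\times W'$). *)

theory Defs
  imports "HOL-Algebra.Coset" "HOL-Algebra.Generated_Groups"
begin

section \<open>Coxeter systems\<close>

text \<open>The value \<open>m s t = 0\<close> encodes \<open>m s t = \<infinity>\<close>, i.e. the absence of a relation.\<close>

definition coxeter_matrix :: "'a set \<Rightarrow> ('a \<Rightarrow> 'a \<Rightarrow> nat) \<Rightarrow> bool" where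
  "coxeter_matrix S m \<longleftrightarrow>
     (\<forall>s\<in>S. m s s = 1) \<and>
     (\<forall>s\<in>S. \<forall>t\<in>S. m s t = m t s) \<and>
     (\<forall>s\<in>S. \<forall>t\<in>S. s \<noteq> t \<longrightarrow> m s t = 0 \<or> m s t \<ge> 2)"

text \<open>
  The congruence on words over \<open>S\<close> generated by \<open>(s t) ^ m s t = 1\<close>. As these relations
  include \<open>s s = 1\<close>, formal inverses are not needed: the quotient monoid is the group
  presented by the generators \<open>S\<close> and the relations \<open>(s t) ^ m s t = 1\<close>.
\<close>

inductive coxeter_cong :: "'a set \<Rightarrow> ('a \<Rightarrow> 'a \<Rightarrow> nat) \<Rightarrow> 'a list \<Rightarrow> 'a list \<Rightarrow> bool"
  for S :: "'a set" and m :: "'a \<Rightarrow> 'a \<Rightarrow> nat" where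
  rel: "\<lbrakk>u \<in> lists S; v \<in> lists S; s \<in> S; t \<in> S; m s t \<noteq> 0\<rbrakk>
    \<Longrightarrow> coxeter_cong S m (u @ concat (replicate (m s t) [s, t]) @ v) (u @ v)"
| refl: "u \<in> lists S \<Longrightarrow> coxeter_cong S m u u"
| sym: "coxeter_cong S m u v \<Longrightarrow> coxeter_cong S m v u"
| trans: "\<lbrakk>coxeter_cong S m u v; coxeter_cong S m v w\<rbrakk> \<Longrightarrow> coxeter_cong S m u w"

definition word_prod :: "'a monoid \<Rightarrow> 'a list \<Rightarrow> 'a" where
  "word_prod W u = foldr (\<otimes>\<^bsub>W\<^esub>) u \<one>\<^bsub>W\<^esub>"

definition coxeter_system :: "'a monoid \<Rightarrow> 'a set \<Rightarrow> bool" where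
  "coxeter_system W S \<longleftrightarrow>
     group W \<and> S \<subseteq> carrier W \<and> generate W S = carrier W \<and>
     (\<exists>m. coxeter_matrix S m \<and>
        (\<forall>u\<in>lists S. \<forall>v\<in>lists S. word_prod W u = word_prod W v \<longleftrightarrow> coxeter_cong S m u v))"

definition cox_length :: "'a monoid \<Rightarrow> 'a set \<Rightarrow> 'a \<Rightarrow> nat" where
  "cox_length W S w = (LEAST n. \<exists>u\<in>lists S. length u = n \<and> word_prod W u = w)"

definition reflections :: "'a monoid \<Rightarrow> 'a set \<Rightarrow> 'a set" where
  "reflections W S = {w \<otimes>\<^bsub>W\<^esub> s \<otimes>\<^bsub>W\<^esub> inv\<^bsub>W\<^esub> w | w s. w \<in> carrier W \<and> s \<in> S}"

definition bruhat_le :: "'a monoid \<Rightarrow> 'a set \<Rightarrow> 'a \<Rightarrow> 'a \<Rightarrow> bool" where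
  "bruhat_le W S x y \<longleftrightarrow>
     (x, y) \<in> {(u, u \<otimes>\<^bsub>W\<^esub> t) | u t. u \<in> carrier W \<and> t \<in> reflections W S \<and>
                  cox_length W S u < cox_length W S (u \<otimes>\<^bsub>W\<^esub> t)}\<^sup>*"

text \<open>The relation written \<open>w = x.y\<close>.\<close>

definition reduced_product :: "'a monoid \<Rightarrow> 'a set \<Rightarrow> 'a \<Rightarrow> 'a \<Rightarrow> 'a \<Rightarrow> bool" where
  "reduced_product W S w x y \<longleftrightarrow>
     w = x \<otimes>\<^bsub>W\<^esub> y \<and> cox_length W S w = cox_length W S x + cox_length W S y"


section \<open>Finitary subsets and double cosets\<close>

text \<open>The parabolic subgroup of \<open>I \<subseteq> S\<close> is \<^term>\<open>generate W I\<close>.\<close>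

definition finitary :: "'a monoid \<Rightarrow> 'a set \<Rightarrow> 'a set \<Rightarrow> bool" where
  "finitary W S I \<longleftrightarrow> I \<subseteq> S \<and> finite (generate W I)"

definition longest :: "'a monoid \<Rightarrow> 'a set \<Rightarrow> 'a set \<Rightarrow> 'a" where
  "longest W S I =
     (THE w. w \<in> generate W I \<and> (\<forall>v\<in>generate W I. cox_length W S v \<le> cox_length W S w))"

definition par_length :: "'a monoid \<Rightarrow> 'a set \<Rightarrow> 'a set \<Rightarrow> nat" where
  "par_length W S I = cox_length W S (longest W S I)"

text \<open>\<open>DCoset J I A\<close> is the set \<open>A\<close> regarded as a \<open>(J, I)\<close>-coset; the pair is part of the data.\<close>

datatype 'a dcoset = DCoset (dleft: "'a set") (dright: "'a set") (elems: "'a set")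

definition is_dcoset :: "'a monoid \<Rightarrow> 'a set \<Rightarrow> 'a set \<Rightarrow> 'a set \<Rightarrow> 'a dcoset \<Rightarrow> bool" where
  "is_dcoset W S J I p \<longleftrightarrow>
     finitary W S J \<and> finitary W S I \<and>
     (\<exists>x\<in>carrier W. p = DCoset J I (generate W J <#>\<^bsub>W\<^esub> (x <#\<^bsub>W\<^esub> generate W I)))"

definition dcoset_containing ::
    "'a monoid \<Rightarrow> 'a set \<Rightarrow> 'a set \<Rightarrow> 'a set \<Rightarrow> 'a set \<Rightarrow> 'a dcoset" where
  "dcoset_containing W S J I A = (THE p. is_dcoset W S J I p \<and> A \<subseteq> elems p)"

definition dmax :: "'a monoid \<Rightarrow> 'a set \<Rightarrow> 'a dcoset \<Rightarrow> 'a" where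
  "dmax W S p = (THE x. x \<in> elems p \<and> (\<forall>y\<in>elems p. bruhat_le W S x y \<longrightarrow> y = x))"

definition dmin :: "'a monoid \<Rightarrow> 'a set \<Rightarrow> 'a dcoset \<Rightarrow> 'a" where
  "dmin W S p = (THE x. x \<in> elems p \<and> (\<forall>y\<in>elems p. bruhat_le W S y x \<longrightarrow> y = x))"

definition conj_set :: "'a monoid \<Rightarrow> 'a \<Rightarrow> 'a set \<Rightarrow> 'a set" where
  "conj_set W x I = (\<lambda>s. x \<otimes>\<^bsub>W\<^esub> s \<otimes>\<^bsub>W\<^esub> inv\<^bsub>W\<^esub> x) ` I"

text \<open>\<open>J \<inter> x I x\<^sup>-\<^sup>1\<close> for a \<open>(J, I)\<close>-coset with minimal element \<open>x\<close>.\<close>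

definition left_redundancy :: "'a monoid \<Rightarrow> 'a set \<Rightarrow> 'a dcoset \<Rightarrow> 'a set" where
  "left_redundancy W S p = dleft p \<inter> conj_set W (dmin W S p) (dright p)"

definition dlen_plus :: "'a monoid \<Rightarrow> 'a set \<Rightarrow> 'a dcoset \<Rightarrow> int" where
  "dlen_plus W S p = int (cox_length W S (dmax W S p)) - int (par_length W S (dleft p))"

definition dlen_minus :: "'a monoid \<Rightarrow> 'a set \<Rightarrow> 'a dcoset \<Rightarrow> int" where
  "dlen_minus W S p =
     int (cox_length W S (dmin W S p)) + int (par_length W S (dleft p))
       - int (par_length W S (left_redundancy W S p))"


section \<open>Singular expressions\<close>

definition is_expression :: "'a monoid \<Rightarrow> 'a set \<Rightarrow> 'a set list \<Rightarrow> bool" where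
  "is_expression W S Is \<longleftrightarrow>
     Is \<noteq> [] \<and> (\<forall>I\<in>set Is. finitary W S I) \<and>
     (\<forall>i. Suc i < length Is \<longrightarrow>
        (\<exists>s\<in>S. s \<notin> Is ! i \<and> Is ! Suc i = insert s (Is ! i) \<or>
               s \<notin> Is ! Suc i \<and> Is ! i = insert s (Is ! Suc i)))"

primrec forward_path :: "'a monoid \<Rightarrow> 'a set \<Rightarrow> 'a set list \<Rightarrow> nat \<Rightarrow> 'a dcoset" where
  "forward_path W S Is 0 = dcoset_containing W S (Is ! 0) (Is ! 0) {\<one>\<^bsub>W\<^esub>}"
| "forward_path W S Is (Suc i) =
     dcoset_containing W S (Is ! 0) (Is ! Suc i)
       (if Is ! i \<subset> Is ! Suc i then elems (forward_path W S Is i)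
        else {dmax W S (forward_path W S Is i)})"

definition expresses :: "'a monoid \<Rightarrow> 'a set \<Rightarrow> 'a set list \<Rightarrow> 'a dcoset \<Rightarrow> bool" where
  "expresses W S Is p \<longleftrightarrow> is_expression W S Is \<and> forward_path W S Is (length Is - 1) = p"

definition reduced_expression :: "'a monoid \<Rightarrow> 'a set \<Rightarrow> 'a set list \<Rightarrow> bool" where
  "reduced_expression W S Is \<longleftrightarrow>
     is_expression W S Is \<and>
     (\<forall>i. Suc i < length Is \<longrightarrow> Is ! i \<subset> Is ! Suc i \<longrightarrow>
        dmin W S (forward_path W S Is i) = dmin W S (forward_path W S Is (Suc i)) \<and>
        left_redundancy W S (forward_path W S Is i) =
          left_redundancy W S (forward_path W S Is (Suc i)))"

definition elen_plus :: "'a monoid \<Rightarrow> 'a set \<Rightarrow> 'a set list \<Rightarrow> int" where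
  "elen_plus W S Is =
     (\<Sum>i | 1 \<le> i \<and> i < length Is \<and> Is ! (i - 1) \<subset> Is ! i.
        int (par_length W S (Is ! i)) - int (par_length W S (Is ! (i - 1))))"

definition elen_minus :: "'a monoid \<Rightarrow> 'a set \<Rightarrow> 'a set list \<Rightarrow> int" where
  "elen_minus W S Is =
     (\<Sum>i | 1 \<le> i \<and> i < length Is \<and> Is ! i \<subset> Is ! (i - 1).
        int (par_length W S (Is ! (i - 1))) - int (par_length W S (Is ! i)))"


section \<open>The product construction\<close>

definition in_left :: "'b monoid \<Rightarrow> 'a \<Rightarrow> 'a \<times> 'b" where
  "in_left W' x = (x, \<one>\<^bsub>W'\<^esub>)"

definition in_right :: "'a monoid \<Rightarrow> 'b \<Rightarrow> 'a \<times> 'b" where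
  "in_right W y = (\<one>\<^bsub>W\<^esub>, y)"

definition gen_union :: "'a monoid \<Rightarrow> 'b monoid \<Rightarrow> 'a set \<Rightarrow> 'b set \<Rightarrow> ('a \<times> 'b) set" where
  "gen_union W W' I J = in_left W' ` I \<union> in_right W ` J"

definition expr_plus ::
    "'a monoid \<Rightarrow> 'b monoid \<Rightarrow> 'a set list \<Rightarrow> 'b set \<Rightarrow> ('a \<times> 'b) set list" where
  "expr_plus W W' Is J = map (\<lambda>I. gen_union W W' I J) Is"

definition dcoset_plus ::
    "'a monoid \<Rightarrow> 'a set \<Rightarrow> 'b monoid \<Rightarrow> 'b set \<Rightarrow> 'a dcoset \<Rightarrow> 'b set \<Rightarrow> ('a \<times> 'b) dcoset" where
  "dcoset_plus W S W' S' p J =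
     dcoset_containing (W \<times>\<times> W') (gen_union W W' S S')
       (gen_union W W' (dleft p) J) (gen_union W W' (dright p) J)
       {in_left W' (dmax W S p) \<otimes>\<^bsub>W \<times>\<times> W'\<^esub> in_right W (longest W' S' J)}"

end

theory Submission
  imports Defs
begin

text \<open>
  The product with \<open>J\<close> does nothing in the first factor and only adds the double coset
  \<open>W'\<^sub>J\<close> of the identity in the second one: \<open>p\<^sup>(\<^sup>+\<^sup>J\<^sup>)\<close> is \<open>p \<times> W'\<^sub>J\<close>. Lengths in
  \<open>W \<times> W'\<close> are sums of lengths, a componentwise Bruhat relation is a Bruhat relation in the product,
  and \<open>W'\<^sub>J\<close> has greatest element \<open>w\<^sub>J\<close> and least element \<open>e\<close>. Hence \<open>p \<times> W'\<^sub>J\<close> has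
  greatest element \<open>(max p, w\<^sub>J)\<close> and least element \<open>(min p, e)\<close>, its redundancy is that of \<open>p\<close>
  together with \<open>J\<close>, and the contributions of \<open>\<ell>(J)\<close> cancel in all four length functions.
  The forward path of the product expression is the product of the forward path with \<open>W'\<^sub>J\<close>
  (\<open>forward_path_plus\<close>); since \<open>p \<mapsto> p \<times> W'\<^sub>J\<close> is injective, expressing and being
  reduced can be tested in \<open>W\<close>.

  The substance is that maximal, minimal and longest elements exist uniquely. A double coset contains
  an element of least and, being finite, one of greatest length. Such an element is Bruhat-extremal, and
  a Bruhat-extremal element is comparable in the right direction with all its translates by the
  generators of the two parabolic subgroups. The lifting property of the Bruhat order spreads this
  comparison over the whole double coset (\<open>dcoset_maximal_greatest\<close>, \<open>dcoset_minimal_least\<close>),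
  so the extremal element is a greatest or least element, hence unique.

  Lifting follows from the strong exchange property, and this is obtained from the presentation:
  the parity of the number of times a reflection is met along a word is unchanged by the defining
  relations (\<open>inversion_parity_invariant\<close>).
\<close>

section \<open>Words in a Coxeter group\<close>

declare in_lists_conv_set [simp]

lemma word_prod_Nil [simp]: "word_prod G [] = \<one>\<^bsub>G\<^esub>"
  by (simp add: word_prod_def)

lemma word_prod_Cons [simp]: "word_prod G (a # u) = a \<otimes>\<^bsub>G\<^esub> word_prod G u"
  by (simp add: word_prod_def)

lemma cox_length_le: "u \<in> lists S \<Longrightarrow> cox_length W S (word_prod W u) \<le> length u"
  unfolding cox_length_def by (rule Least_le) auto

lemma reduced_word_exists:
  assumes "u \<in> lists S"
  shows "\<exists>v\<in>lists S. length v = cox_length W S (word_prod W u) \<and> word_prod W v = word_prod W u"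
  unfolding cox_length_def by (rule LeastI_ex) (use assms in blast)

locale coxeter = group W for W :: "'a monoid" (structure) +
  fixes S :: "'a set"
  assumes system: "coxeter_system W S"
begin

lemma inv_cancel [simp]:
  "x \<in> carrier W \<Longrightarrow> y \<in> carrier W \<Longrightarrow> inv x \<otimes> (x \<otimes> y) = y"
  "x \<in> carrier W \<Longrightarrow> y \<in> carrier W \<Longrightarrow> x \<otimes> (inv x \<otimes> y) = y"
  by (simp_all flip: m_assoc)

abbreviation len :: "'a \<Rightarrow> nat" where "len \<equiv> cox_length W S"
abbreviation wp :: "'a list \<Rightarrow> 'a" where "wp \<equiv> word_prod W"

lemma gens_subset: "S \<subseteq> carrier W"
  using system by (simp add: coxeter_system_def)

lemma gen_closed [simp]: "s \<in> S \<Longrightarrow> s \<in> carrier W"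
  using gens_subset by blast

lemma wp_closed [simp]: "u \<in> lists S \<Longrightarrow> wp u \<in> carrier W"
  by (induction u) auto

lemma wp_append: "u \<in> lists S \<Longrightarrow> v \<in> lists S \<Longrightarrow> wp (u @ v) = wp u \<otimes> wp v"
  by (induction u) (auto simp: m_assoc)

lemma presentation:
  obtains m where "coxeter_matrix S m"
    and "\<And>u v. u \<in> lists S \<Longrightarrow> v \<in> lists S \<Longrightarrow> wp u = wp v \<longleftrightarrow> coxeter_cong S m u v"
  using system by (auto simp: coxeter_system_def)

lemma gen_sq [simp]:
  assumes "s \<in> S" shows "s \<otimes> s = \<one>"
proof -
  obtain m where m: "coxeter_matrix S m"
    and c: "\<And>u v. u \<in> lists S \<Longrightarrow> v \<in> lists S \<Longrightarrow> wp u = wp v \<longleftrightarrow> coxeter_cong S m u v"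
    by (rule presentation) blast
  have "m s s = 1" using m assms by (simp add: coxeter_matrix_def)
  with coxeter_cong.rel[of "[]" S "[]" s s m] assms have "coxeter_cong S m [s, s] []"
    by simp
  with c[of "[s, s]" "[]"] assms show ?thesis by simp
qed

lemma inv_gen [simp]: "s \<in> S \<Longrightarrow> inv s = s"
  by (simp add: inv_equality)

lemma gen_cancel [simp]: "s \<in> S \<Longrightarrow> x \<in> carrier W \<Longrightarrow> s \<otimes> (s \<otimes> x) = x"
  by (simp flip: m_assoc)

lemma wp_rev: "u \<in> lists S \<Longrightarrow> wp (rev u) = inv (wp u)"
  by (induction u) (auto simp: wp_append inv_mult_group)

lemma generate_words:
  assumes "I \<subseteq> S"
  shows "generate W I = wp ` lists I"
proof
  have ls: "u \<in> lists S" if "u \<in> lists I" for u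
    using that assms by auto
  show "generate W I \<subseteq> wp ` lists I"
  proof
    fix x assume "x \<in> generate W I"
    then show "x \<in> wp ` lists I"
    proof induction
      case one
      then show ?case by (auto intro: image_eqI[of _ _ "[]"])
    next
      case (incl h)
      then show ?case using assms by (auto intro!: image_eqI[of _ _ "[h]"])
    next
      case (inv h)
      then show ?case using assms by (auto intro!: image_eqI[of _ _ "[h]"])
    next
      case (eng g h)
      then obtain u v where "u \<in> lists I" "v \<in> lists I" "g = wp u" "h = wp v" by blast
      then show ?case
        using ls by (intro image_eqI[of _ _ "u @ v"]) (auto simp: wp_append)
    qed
  qed
  have "wp u \<in> generate W I" if "u \<in> lists I" for u
    using that by (induction u) (auto intro: generate.intros)
  then show "wp ` lists I \<subseteq> generate W I" by blast
qed

lemma carrier_words: "carrier W = wp ` lists S"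
  using system generate_words[of S] by (simp add: coxeter_system_def)

lemma reduced_word:
  assumes "w \<in> carrier W"
  obtains u where "u \<in> lists S" "wp u = w" "length u = len w"
  using assms reduced_word_exists[of _ S W] unfolding carrier_words by force

lemma len_inv:
  assumes "w \<in> carrier W" shows "len (inv w) = len w"
proof -
  have le: "len (inv x) \<le> len x" if x: "x \<in> carrier W" for x
  proof -
    obtain u where "u \<in> lists S" "wp u = x" "length u = len x" using reduced_word[OF x] .
    then show ?thesis
      using cox_length_le[of "rev u" S W] wp_rev by simp
  qed
  show ?thesis using le[of w] le[of "inv w"] assms by simp
qed

text \<open>The defining relations have even length, so the parity of a word is an invariant of its
  product. In particular no generator is trivial, and a reflection always changes the length.\<close>

lemma parity_invariant:
  assumes "u \<in> lists S" "v \<in> lists S" "wp u = wp v"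
  shows "even (length u) \<longleftrightarrow> even (length v)"
proof -
  obtain m where
    c: "\<And>u v. u \<in> lists S \<Longrightarrow> v \<in> lists S \<Longrightarrow> wp u = wp v \<longleftrightarrow> coxeter_cong S m u v"
    by (rule presentation) blast
  have "coxeter_cong S m u v" using c assms by blast
  then show ?thesis
    by induction (auto simp: length_concat sum_list_replicate)
qed

lemma one_notin_gens: "\<one> \<notin> S"
  using parity_invariant[of "[\<one>]" "[]"] by auto

section \<open>Reflections and the strong exchange property\<close>

lemma reflection_closed [simp]: "r \<in> reflections W S \<Longrightarrow> r \<in> carrier W"
  by (auto simp: reflections_def)

lemma reflection_word:
  assumes "r \<in> reflections W S"
  obtains g s where "g \<in> lists S" "s \<in> S" "r = wp g \<otimes> s \<otimes> inv (wp g)" "r = wp (g @ s # rev g)"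
proof -
  obtain w s where "w \<in> carrier W" "s \<in> S" "r = w \<otimes> s \<otimes> inv w"
    using assms unfolding reflections_def by blast
  moreover obtain g where "g \<in> lists S" "wp g = w"
    using reduced_word[OF \<open>w \<in> carrier W\<close>] by blast
  ultimately have "r = wp g \<otimes> s \<otimes> inv (wp g)" "r = wp (g @ s # rev g)"
    by (auto simp: wp_append wp_rev m_assoc)
  with \<open>g \<in> lists S\<close> \<open>s \<in> S\<close> show ?thesis by (rule that)
qed

lemma reflection_conj:
  assumes "r \<in> reflections W S" "x \<in> carrier W"
  shows "x \<otimes> r \<otimes> inv x \<in> reflections W S"
proof -
  obtain w s where w: "w \<in> carrier W" "s \<in> S" "r = w \<otimes> s \<otimes> inv w"
    using assms unfolding reflections_def by blast
  then have "x \<otimes> r \<otimes> inv x = (x \<otimes> w) \<otimes> s \<otimes> inv (x \<otimes> w)"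
    using assms by (simp add: inv_mult_group m_assoc)
  then show ?thesis using w assms m_closed unfolding reflections_def by blast
qed

lemma gen_reflection: "s \<in> S \<Longrightarrow> s \<in> reflections W S"
  unfolding reflections_def by (intro CollectI exI[of _ \<one>] exI[of _ s]) simp

lemma reflection_sq:
  assumes "r \<in> reflections W S" shows "r \<otimes> r = \<one>"
proof -
  obtain g s where g: "g \<in> lists S" "s \<in> S" "r = wp g \<otimes> s \<otimes> inv (wp g)"
    using reflection_word[OF assms] by metis
  show ?thesis using g(1,2) unfolding g(3) by (simp add: m_assoc)
qed

lemma len_reflection_neq:
  assumes "x \<in> carrier W" "r \<in> reflections W S"
  shows "len (x \<otimes> r) \<noteq> len x"
proof
  assume eq: "len (x \<otimes> r) = len x"
  obtain g s where g: "g \<in> lists S" "s \<in> S" "r = wp (g @ s # rev g)"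
    using reflection_word[OF assms(2)] by metis
  obtain u where u: "u \<in> lists S" "wp u = x" "length u = len x" using reduced_word[OF assms(1)] .
  obtain v where v: "v \<in> lists S" "wp v = x \<otimes> r" "length v = len (x \<otimes> r)"
    using reduced_word[of "x \<otimes> r"] assms reflection_closed by blast
  have "wp (u @ g @ s # rev g) = wp v"
    using g u v by (simp add: wp_append)
  then have "even (length (u @ g @ s # rev g)) \<longleftrightarrow> even (length v)"
    using g u v by (intro parity_invariant) auto
  then show False using eq u v by simp
qed

text \<open>For a word \<open>s\<^sub>1 \<dots> s\<^sub>n\<close>, this counts the positions \<open>i\<close> whose deletion multiplies the product
  by \<open>r\<close> on the right, that is, with \<open>r = (s\<^sub>n \<dots> s\<^sub>i\<^sub>+\<^sub>1) s\<^sub>i (s\<^sub>i\<^sub>+\<^sub>1 \<dots> s\<^sub>n)\<close>. Its parity is the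
  cocycle by which \<open>W\<close> acts on signed reflections.\<close>

primrec inversion_count :: "'a list \<Rightarrow> 'a \<Rightarrow> nat" where
  "inversion_count [] r = 0"
| "inversion_count (a # u) r =
     (if inv (wp u) \<otimes> a \<otimes> wp u = r then 1 else 0) + inversion_count u r"

lemma conj_move:
  assumes "a \<in> carrier W" "x \<in> carrier W" "y \<in> carrier W" "r \<in> carrier W"
  shows "inv (x \<otimes> y) \<otimes> a \<otimes> (x \<otimes> y) = r \<longleftrightarrow> inv x \<otimes> a \<otimes> x = y \<otimes> r \<otimes> inv y"
proof -
  have "inv (x \<otimes> y) \<otimes> a \<otimes> (x \<otimes> y) = inv y \<otimes> (inv x \<otimes> a \<otimes> x) \<otimes> y"
    using assms by (simp add: inv_mult_group m_assoc)
  moreover have "inv y \<otimes> z \<otimes> y = r \<longleftrightarrow> z = y \<otimes> r \<otimes> inv y" if "z \<in> carrier W" for z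
    using assms that by (auto simp: m_assoc)
  ultimately show ?thesis using assms by simp
qed

lemma inversion_count_append:
  assumes "u \<in> lists S" "v \<in> lists S" "r \<in> carrier W"
  shows "inversion_count (u @ v) r = inversion_count u (wp v \<otimes> r \<otimes> inv (wp v)) + inversion_count v r"
  using assms by (induction u) (auto simp: wp_append conj_move)

lemma inversion_deletion:
  assumes "u \<in> lists S" "r \<in> carrier W" "inversion_count u r > 0"
  shows "\<exists>v\<in>lists S. length v < length u \<and> wp v = wp u \<otimes> r"
  using assms
proof (induction u rule: list.induct)
  case Nil
  then show ?case by simp
next
  case (Cons a u)
  show ?case
  proof (cases "inv (wp u) \<otimes> a \<otimes> wp u = r")
    case True
    have "wp u = a \<otimes> wp u \<otimes> (inv (wp u) \<otimes> a \<otimes> wp u)"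
      using Cons.prems(1) by (simp add: m_assoc)
    then have "wp u = wp (a # u) \<otimes> r" using True by simp
    then show ?thesis using Cons.prems by (intro bexI[of _ u]) auto
  next
    case False
    then obtain v where v: "v \<in> lists S" "length v < length u" "wp v = wp u \<otimes> r"
      using Cons by auto
    then show ?thesis using Cons.prems
      by (intro bexI[of _ "a # v"]) (auto simp: m_assoc)
  qed
qed

text \<open>The reflections met along the word \<open>(s t)\<^sup>k\<close>, read from the right, are \<open>(t s)\<^sup>j t\<close>.\<close>

lemma inversion_count_dihedral:
  assumes "s \<in> S" "t \<in> S"
  shows "wp (concat (replicate k [s, t])) = (s \<otimes> t) [^] k"
    and "inversion_count (concat (replicate k [s, t])) r =
      (\<Sum>j<2 * k. if (t \<otimes> s) [^] j \<otimes> t = r then 1 else 0)"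
proof -
  show w: "wp (concat (replicate k [s, t])) = (s \<otimes> t) [^] k" for k
  proof (induction k)
    case (Suc k)
    then show ?case
      using assms nat_pow_mult[of "s \<otimes> t" 1 k] by (simp add: m_assoc)
  qed simp
  have flip: "t \<otimes> (s \<otimes> t) [^] k = (t \<otimes> s) [^] k \<otimes> t" for k :: nat
    using assms
  proof (induction k)
    case (Suc k)
    have "t \<otimes> (s \<otimes> t) [^] Suc k = (t \<otimes> (s \<otimes> t) [^] k) \<otimes> (s \<otimes> t)"
      using Suc.prems by (simp add: m_assoc)
    also have "\<dots> = (t \<otimes> s) [^] Suc k \<otimes> t" using Suc by (simp add: m_assoc)
    finally show ?case .
  qed simp
  have inv: "inv ((s \<otimes> t) [^] k) = (t \<otimes> s) [^] k" for k :: nat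
    using assms by (simp add: inv_mult_group flip: nat_pow_inv)
  have c: "inv ((s \<otimes> t) [^] k) \<otimes> t \<otimes> (s \<otimes> t) [^] k = (t \<otimes> s) [^] (2 * k) \<otimes> t" for k :: nat
  proof -
    have "inv ((s \<otimes> t) [^] k) \<otimes> t \<otimes> (s \<otimes> t) [^] k = (t \<otimes> s) [^] k \<otimes> (t \<otimes> (s \<otimes> t) [^] k)"
      using assms by (simp add: inv m_assoc)
    also have "\<dots> = (t \<otimes> s) [^] k \<otimes> ((t \<otimes> s) [^] k \<otimes> t)"
      by (simp only: flip)
    also have "\<dots> = (t \<otimes> s) [^] (2 * k) \<otimes> t"
      using assms by (simp add: nat_pow_mult mult_2 flip: m_assoc)
    finally show ?thesis .
  qed
  have d: "inv (t \<otimes> (s \<otimes> t) [^] k) \<otimes> s \<otimes> (t \<otimes> (s \<otimes> t) [^] k)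
      = (t \<otimes> s) [^] Suc (2 * k) \<otimes> t" for k :: nat
  proof -
    have "inv (t \<otimes> (s \<otimes> t) [^] k) \<otimes> s \<otimes> (t \<otimes> (s \<otimes> t) [^] k)
        = (t \<otimes> s) [^] k \<otimes> (t \<otimes> s) \<otimes> (t \<otimes> (s \<otimes> t) [^] k)"
      using assms by (simp add: inv inv_mult_group m_assoc)
    also have "\<dots> = (t \<otimes> s) [^] Suc k \<otimes> ((t \<otimes> s) [^] k \<otimes> t)"
      by (simp add: flip)
    also have "\<dots> = (t \<otimes> s) [^] Suc (2 * k) \<otimes> t"
      using assms nat_pow_mult[of "t \<otimes> s" "Suc k" k] by (simp add: mult_2 flip: m_assoc)
    finally show ?thesis .
  qed
  show "inversion_count (concat (replicate k [s, t])) r =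
      (\<Sum>j<2 * k. if (t \<otimes> s) [^] j \<otimes> t = r then 1 else 0)"
  proof (induction k)
    case (Suc k)
    have "2 * Suc k = Suc (Suc (2 * k))" by simp
    then show ?case using Suc by (simp add: w c d)
  qed simp
qed

text \<open>Along the relator \<open>(s t)\<^sup>m\<close> the reflections \<open>(t s)\<^sup>j t\<close> occur for \<open>j < 2 m\<close>. As
  \<open>(t s)\<^sup>m = 1\<close>, these repeat with period \<open>m\<close>, so each of them is met an even number of times.\<close>

lemma inversion_parity_invariant:
  assumes "u \<in> lists S" "v \<in> lists S" "wp u = wp v" "r \<in> carrier W"
  shows "even (inversion_count u r) \<longleftrightarrow> even (inversion_count v r)"
proof -
  obtain m where
    c: "\<And>u v. u \<in> lists S \<Longrightarrow> v \<in> lists S \<Longrightarrow> wp u = wp v \<longleftrightarrow> coxeter_cong S m u v"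
    by (rule presentation) blast
  have "coxeter_cong S m u v" using c assms by blast
  then show ?thesis
  proof induction
    case (rel u v s t)
    let ?n = "m s t" and ?d = "concat (replicate (m s t) [s, t])"
    have dS: "?d \<in> lists S" using rel by (induction "m s t") auto
    have d1: "wp ?d = \<one>"
      using c[OF dS, of "[]"] coxeter_cong.rel[of "[]" S "[]" s t m] rel by simp
    then have p1: "(s \<otimes> t) [^] ?n = \<one>" using inversion_count_dihedral(1) rel by metis
    have p2: "(t \<otimes> s) [^] ?n = \<one>"
      using p1 rel nat_pow_inv[of "s \<otimes> t" ?n] by (simp add: inv_mult_group)
    let ?f = "\<lambda>j. (t \<otimes> s) [^] j \<otimes> t"
    have per: "?f (?n + j) = ?f j" for j
      using p2 rel nat_pow_mult[of "t \<otimes> s" ?n j, symmetric] by simp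
    have split: "(\<Sum>j<a + b. g j) = (\<Sum>j<a. g j) + (\<Sum>j<b. g (a + j))" for g :: "nat \<Rightarrow> nat" and a b
      by (induction b) auto
    have "even (inversion_count ?d y)" for y
      using rel by (simp add: inversion_count_dihedral(2) mult_2 split per)
    moreover have "wp (?d @ v) = wp v"
      using dS d1 rel by (simp add: wp_append)
    ultimately show ?case
      using rel dS assms(4) by (simp add: inversion_count_append)
  qed auto
qed

text \<open>If the count for a word of \<open>w\<close> were even, then the count for a word of \<open>w r\<close> would be odd,
  and a deletion in a reduced word of \<open>w r\<close> would produce \<open>w\<close>, making \<open>w\<close> the shorter of the two.\<close>

lemma strong_exchange:
  assumes u: "u \<in> lists S" and r: "r \<in> reflections W S" and less: "len (wp u \<otimes> r) < len (wp u)"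
  shows "inversion_count u r > 0"
proof (rule ccontr)
  assume "\<not> inversion_count u r > 0"
  then have z: "even (inversion_count u r)" by simp
  obtain g s where g: "g \<in> lists S" "s \<in> S" "r = wp g \<otimes> s \<otimes> inv (wp g)" "r = wp (g @ s # rev g)"
    using reflection_word[OF r] .
  have rc: "r \<in> carrier W" using r by simp
  have conj_back: "inv (wp g) \<otimes> r \<otimes> wp g = s"
    using g(1,2) unfolding g(3) by (simp add: m_assoc)
  \<comment> \<open>The word \<open>g g\<^sup>-\<^sup>1\<close> has trivial product, so its count is even. This leaves the middle letter of
    \<open>g s g\<^sup>-\<^sup>1\<close> as the one odd contribution: a palindromic word of \<open>r\<close> meets \<open>r\<close> oddly often.\<close>
  have gg: "even (inversion_count g s + inversion_count (rev g) r)"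
  proof -
    have "even (inversion_count (g @ rev g) r)"
      using inversion_parity_invariant[of "g @ rev g" "[]" r] g rc
      by (simp add: wp_append wp_rev)
    then show ?thesis using g rc conj_back by (simp add: inversion_count_append wp_rev)
  qed
  let ?v = "g @ s # rev g"
  have sg: "wp (s # rev g) \<otimes> r \<otimes> inv (wp (s # rev g)) = s"
    using conj_back g rc by (simp add: wp_rev inv_mult_group m_assoc)
  have "odd (inversion_count ?v r)"
    using g(1,2) rc gg sg g(3)[symmetric]
    by (subst inversion_count_append) (auto simp: wp_rev conj_move)
  moreover have "r \<otimes> r \<otimes> inv r = r"
    using rc by (simp add: m_assoc)
  ultimately have odd: "odd (inversion_count (u @ ?v) r)"
    using z u g(1,2) rc g(4)[symmetric] by (simp add: inversion_count_append[of u ?v])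
  have urc: "wp u \<otimes> r \<in> carrier W" using u rc by simp
  obtain v where v: "v \<in> lists S" "wp v = wp u \<otimes> r" "length v = len (wp u \<otimes> r)"
    using reduced_word[OF urc] .
  have "wp (u @ ?v) = wp v" using u g v by (simp add: wp_append)
  then have "odd (inversion_count v r)"
    using odd inversion_parity_invariant[of "u @ ?v" v r] u g v rc by auto
  then obtain x where "x \<in> lists S" "length x < length v" "wp x = wp v \<otimes> r"
    using inversion_deletion[OF v(1) rc] by (auto simp: odd_pos)
  moreover have "wp v \<otimes> r = wp u"
    using v u rc reflection_sq[OF r] by (simp add: m_assoc)
  ultimately show False
    using cox_length_le[of x S W] v less by simp
qed

end

section \<open>Bruhat order and left multiplication by a generator\<close>

definition bruhat_step :: "'a monoid \<Rightarrow> 'a set \<Rightarrow> 'a \<Rightarrow> 'a \<Rightarrow> bool" where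
  "bruhat_step W S u v \<longleftrightarrow> u \<in> carrier W \<and> (\<exists>t\<in>reflections W S. v = u \<otimes>\<^bsub>W\<^esub> t) \<and>
     cox_length W S u < cox_length W S v"

lemma bruhat_le_steps: "bruhat_le W S = (bruhat_step W S)\<^sup>*\<^sup>*"
proof -
  have "{(u, u \<otimes>\<^bsub>W\<^esub> t) | u t. u \<in> carrier W \<and> t \<in> reflections W S \<and>
          cox_length W S u < cox_length W S (u \<otimes>\<^bsub>W\<^esub> t)} = {(u, v). bruhat_step W S u v}"
    by (auto simp: bruhat_step_def)
  then show ?thesis
    by (intro ext) (simp add: bruhat_le_def rtranclp_rtrancl_eq)
qed

lemma bruhat_le_refl [simp]: "bruhat_le W S x x"
  by (simp add: bruhat_le_steps)

lemma bruhat_le_trans: "bruhat_le W S x y \<Longrightarrow> bruhat_le W S y z \<Longrightarrow> bruhat_le W S x z"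
  by (simp add: bruhat_le_steps)

lemma bruhat_step_le: "bruhat_step W S x y \<Longrightarrow> bruhat_le W S x y"
  by (simp add: bruhat_le_steps)

lemma bruhat_le_length:
  "bruhat_le W S x y \<Longrightarrow> x = y \<or> cox_length W S x < cox_length W S y"
  unfolding bruhat_le_steps
  by (induction rule: rtranclp_induct) (auto simp: bruhat_step_def)

lemma dmax_eqI:
  assumes "x \<in> elems p" "\<And>z. z \<in> elems p \<Longrightarrow> bruhat_le W S z x"
  shows "dmax W S p = x"
  unfolding dmax_def
proof (rule the_equality)
  show "x \<in> elems p \<and> (\<forall>y\<in>elems p. bruhat_le W S x y \<longrightarrow> y = x)"
    using assms bruhat_le_length by (metis order_less_asym)
qed (use assms in blast)

lemma dmin_eqI:
  assumes "x \<in> elems p" "\<And>z. z \<in> elems p \<Longrightarrow> bruhat_le W S x z"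
  shows "dmin W S p = x"
  unfolding dmin_def
proof (rule the_equality)
  show "x \<in> elems p \<and> (\<forall>y\<in>elems p. bruhat_le W S y x \<longrightarrow> y = x)"
    using assms bruhat_le_length by (metis order_less_asym)
qed (use assms in blast)

lemma longest_eqI:
  assumes "x \<in> generate W I" "\<And>z. z \<in> generate W I \<Longrightarrow> bruhat_le W S z x"
  shows "longest W S I = x"
  unfolding longest_def
proof (rule the_equality)
  show "x \<in> generate W I \<and> (\<forall>v\<in>generate W I. cox_length W S v \<le> cox_length W S x)"
    using assms bruhat_le_length by (metis order_less_imp_le order_refl)
  show "w = x" if "w \<in> generate W I \<and> (\<forall>v\<in>generate W I. cox_length W S v \<le> cox_length W S w)" for w
    using that assms bruhat_le_length by (metis leD)
qed

context coxeter
begin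

abbreviation le :: "'a \<Rightarrow> 'a \<Rightarrow> bool" (infix "\<preceq>" 50) where "x \<preceq> y \<equiv> bruhat_le W S x y"

text \<open>Suppose \<open>s a r\<close> is shorter than \<open>s a\<close>. By strong exchange it arises from \<open>s\<close> followed by a
  reduced word of \<open>a\<close> by deleting a letter. Deleting a letter of \<open>a\<close> would make \<open>a r\<close> shorter
  than \<open>a\<close>, so the deleted letter is the initial \<open>s\<close>.\<close>

lemma bruhat_step_gen_mult:
  assumes step: "bruhat_step W S a b" and s: "s \<in> S"
  shows "bruhat_step W S (s \<otimes> a) (s \<otimes> b) \<or> s \<otimes> b = a"
proof (cases "len (s \<otimes> a) < len (s \<otimes> b)")
  case True
  then show ?thesis using step s by (auto simp: bruhat_step_def m_assoc)
next
  case False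
  obtain r where a: "a \<in> carrier W" and r: "r \<in> reflections W S" and b: "b = a \<otimes> r"
    and less: "len a < len b"
    using step by (auto simp: bruhat_step_def)
  obtain u where u: "u \<in> lists S" "wp u = a" "length u = len a" using reduced_word[OF a] .
  have "len (wp (s # u) \<otimes> r) < len (wp (s # u))"
    using False len_reflection_neq[of "s \<otimes> a" r] a r b s u by (simp add: m_assoc)
  then have pos: "inversion_count (s # u) r > 0"
    using strong_exchange[of "s # u" r] u s r by simp
  have "\<not> inversion_count u r > 0"
  proof
    assume "inversion_count u r > 0"
    then obtain v where "v \<in> lists S" "length v < length u" "wp v = b"
      using inversion_deletion[of u r] u r b by auto
    then show False using cox_length_le[of v S W] less u by simp
  qed
  then have "inv a \<otimes> s \<otimes> a = r" using pos u by (auto split: if_splits)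
  then have "s \<otimes> b = s \<otimes> (a \<otimes> (inv a \<otimes> s \<otimes> a))" using b by simp
  also have "\<dots> = a" using a s by (simp add: m_assoc)
  finally show ?thesis by simp
qed

text \<open>A Bruhat chain is multiplied by \<open>s\<close> on the left step by step. A step that fails to survive is
  of the form \<open>a, s a\<close>; at such a step the original and the translated chain exchange their roles.\<close>

lemma bruhat_le_gen_mult_lower:
  assumes "a \<preceq> b" "s \<in> S" "a \<in> carrier W"
  shows "s \<otimes> a \<preceq> b \<or> s \<otimes> a \<preceq> s \<otimes> b"
  using assms(1)[unfolded bruhat_le_steps]
proof (induction rule: rtranclp_induct)
  case (step b c)
  have bc: "b \<preceq> c" using step(2) by (rule bruhat_step_le)
  have "c \<in> carrier W" using step(2) by (auto simp: bruhat_step_def)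
  then have "s \<otimes> c = b \<Longrightarrow> s \<otimes> b = c" using assms(2) by auto
  then consider "s \<otimes> b \<preceq> s \<otimes> c" | "s \<otimes> b = c"
    using bruhat_step_gen_mult[OF step(2) assms(2)]
    by (blast intro: bruhat_step_le)
  then show ?case
  proof cases
    case 1
    then show ?thesis using step.IH bc by (blast intro: bruhat_le_trans)
  next
    case 2
    then show ?thesis using step.IH bc by (auto intro: bruhat_le_trans)
  qed
qed simp

lemma bruhat_le_gen_mult_upper:
  assumes "a \<preceq> b" "s \<in> S"
  shows "a \<preceq> s \<otimes> b \<or> s \<otimes> a \<preceq> s \<otimes> b"
  using assms(1)[unfolded bruhat_le_steps]
proof (induction rule: converse_rtranclp_induct)
  case (step a c)
  have ac: "a \<preceq> c" using step(1) by (rule bruhat_step_le)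
  have "c \<in> carrier W" using step(1) by (auto simp: bruhat_step_def)
  then have "s \<otimes> c = a \<Longrightarrow> c = s \<otimes> a" using assms(2) by auto
  then consider "s \<otimes> a \<preceq> s \<otimes> c" | "s \<otimes> c = a" "c = s \<otimes> a"
    using bruhat_step_gen_mult[OF step(1) assms(2)]
    by (blast intro: bruhat_step_le)
  then show ?case
  proof cases
    case 1
    then show ?thesis using step.IH ac by (blast intro: bruhat_le_trans)
  next
    case 2
    then show ?thesis using step.IH by metis
  qed
qed simp

lemma lifting_below:
  assumes "z \<preceq> x" "s \<otimes> x \<preceq> x" "s \<in> S" "z \<in> carrier W"
  shows "s \<otimes> z \<preceq> x"
  using bruhat_le_gen_mult_lower[OF assms(1,3,4)] assms(2) by (blast intro: bruhat_le_trans)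

lemma lifting_above:
  assumes "x \<preceq> z" "x \<preceq> s \<otimes> x" "s \<in> S"
  shows "x \<preceq> s \<otimes> z"
  using bruhat_le_gen_mult_upper[OF assms(1,3)] assms(2) by (blast intro: bruhat_le_trans)

lemma bruhat_inv:
  assumes "a \<preceq> b" shows "inv a \<preceq> inv b"
  using assms unfolding bruhat_le_steps
proof (induction rule: rtranclp_induct)
  case (step b c)
  obtain r where b: "b \<in> carrier W" and r: "r \<in> reflections W S" "c = b \<otimes> r" "len b < len c"
    using step(2) by (auto simp: bruhat_step_def)
  have "inv r = r" using r reflection_sq by (simp add: inv_equality)
  then have "inv c = inv b \<otimes> (b \<otimes> r \<otimes> inv b)"
    using b r by (simp add: inv_mult_group m_assoc)
  moreover have "len (inv b) < len (inv c)"
    using b r by (simp add: len_inv)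
  ultimately have "bruhat_step W S (inv b) (inv c)"
    using b reflection_conj[OF r(1) b] unfolding bruhat_step_def by blast
  with step(3) show ?case by simp
qed simp

lemma bruhat_comparable:
  assumes "x \<in> carrier W" "s \<in> S"
  shows "x \<preceq> s \<otimes> x \<or> s \<otimes> x \<preceq> x"
proof -
  define r where "r = inv x \<otimes> s \<otimes> x"
  have r: "r \<in> reflections W S"
    using reflection_conj[OF gen_reflection[OF assms(2)], of "inv x"] assms by (simp add: r_def)
  have sx: "s \<otimes> x = x \<otimes> r" "x = s \<otimes> x \<otimes> r"
    using assms by (simp_all add: r_def m_assoc)
  have "bruhat_step W S x (s \<otimes> x) \<or> bruhat_step W S (s \<otimes> x) x"
    using len_reflection_neq[OF assms(1) r] r sx assms unfolding bruhat_step_def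
    by (metis gen_closed linorder_neqE_nat m_closed)
  then show ?thesis by (auto intro: bruhat_step_le)
qed

text \<open>Passing to inverses turns the right-hand versions into the left-hand ones.\<close>

lemma lifting_below_right:
  assumes "z \<preceq> x" "x \<otimes> s \<preceq> x" "s \<in> S" "z \<in> carrier W" "x \<in> carrier W"
  shows "z \<otimes> s \<preceq> x"
  using bruhat_inv[OF lifting_below[of "inv z" "inv x" s]]
    bruhat_inv[OF assms(1)] bruhat_inv[OF assms(2)] assms(3-5)
  by (simp add: inv_mult_group)

lemma lifting_above_right:
  assumes "x \<preceq> z" "x \<preceq> x \<otimes> s" "s \<in> S" "z \<in> carrier W" "x \<in> carrier W"
  shows "x \<preceq> z \<otimes> s"
  using bruhat_inv[OF lifting_above[of "inv x" "inv z" s]]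
    bruhat_inv[OF assms(1)] bruhat_inv[OF assms(2)] assms(3-5)
  by (simp add: inv_mult_group)

lemma bruhat_comparable_right:
  assumes "x \<in> carrier W" "s \<in> S"
  shows "x \<preceq> x \<otimes> s \<or> x \<otimes> s \<preceq> x"
  using bruhat_comparable[of "inv x" s] bruhat_inv[of "inv x" "s \<otimes> inv x"]
    bruhat_inv[of "s \<otimes> inv x" "inv x"] assms
  by (auto simp: inv_mult_group)

end

section \<open>Double cosets and their extremal elements\<close>

definition double_coset :: "'a monoid \<Rightarrow> 'a set \<Rightarrow> 'a \<Rightarrow> 'a set \<Rightarrow> 'a set" where
  "double_coset G J x I = generate G J <#>\<^bsub>G\<^esub> (x <#\<^bsub>G\<^esub> generate G I)"

lemma is_dcoset_iff:
  "is_dcoset G S J I p \<longleftrightarrow>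
     finitary G S J \<and> finitary G S I \<and> (\<exists>x\<in>carrier G. p = DCoset J I (double_coset G J x I))"
  by (simp add: is_dcoset_def double_coset_def)

lemma is_dcoset_pair:
  assumes "is_dcoset G S J I p"
  shows "dleft p = J" "dright p = I" "finitary G S J" "finitary G S I"
  using assms by (auto simp: is_dcoset_iff)

context
  fixes G :: "'a monoid" (structure) and S :: "'a set"
  assumes G: "group G" and S: "S \<subseteq> carrier G"
begin

interpretation group G by (fact G)

lemma generate_finitary_closed: "finitary G S I \<Longrightarrow> x \<in> generate G I \<Longrightarrow> x \<in> carrier G"
  using generate_incl S by (auto simp: finitary_def)

lemma mem_double_coset:
  assumes "J \<subseteq> S" "I \<subseteq> S" "x \<in> carrier G"
  shows "y \<in> double_coset G J x I \<longleftrightarrow> (\<exists>u\<in>generate G J. \<exists>v\<in>generate G I. y = u \<otimes> x \<otimes> v)"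
proof -
  have "generate G J \<subseteq> carrier G" "generate G I \<subseteq> carrier G"
    using assms S generate_incl by auto
  then have "u \<otimes> (x \<otimes> v) = u \<otimes> x \<otimes> v" if "u \<in> generate G J" "v \<in> generate G I" for u v
    using that assms by (metis m_assoc subsetD)
  then show ?thesis
    unfolding double_coset_def set_mult_def l_coset_def by force
qed

lemma double_coset_self:
  assumes "J \<subseteq> S" "I \<subseteq> S" "x \<in> carrier G"
  shows "x \<in> double_coset G J x I"
  unfolding mem_double_coset[OF assms]
  by (rule bexI[of _ \<one>], rule bexI[of _ \<one>]) (use assms in \<open>auto intro: generate.one\<close>)

lemma double_coset_mono:
  assumes "J \<subseteq> S" "I \<subseteq> I'" "I' \<subseteq> S" "x \<in> carrier G" "y \<in> double_coset G J x I'"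
  shows "double_coset G J y I \<subseteq> double_coset G J x I'"
proof
  fix z assume z: "z \<in> double_coset G J y I"
  have c: "generate G J \<subseteq> carrier G" "generate G I' \<subseteq> carrier G"
    using assms S generate_incl by auto
  obtain u v where uv: "u \<in> generate G J" "v \<in> generate G I'" "y = u \<otimes> x \<otimes> v"
    using assms mem_double_coset[of J I' x y] by auto
  then have yc: "y \<in> carrier G" using c assms by auto
  obtain u' v' where uv': "u' \<in> generate G J" "v' \<in> generate G I'" "z = u' \<otimes> y \<otimes> v'"
    using z assms mem_double_coset[of J I y z] yc mono_generate[of I I'] by auto
  have "z = (u' \<otimes> u) \<otimes> x \<otimes> (v \<otimes> v')"
    using uv uv' c assms by (auto simp: m_assoc subset_iff)
  then show "z \<in> double_coset G J x I'"
    using uv uv' assms mem_double_coset[of J I' x z] by (auto intro: generate.eng)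
qed

lemma double_coset_eq:
  assumes "J \<subseteq> S" "I \<subseteq> S" "x \<in> carrier G" "y \<in> double_coset G J x I"
  shows "double_coset G J y I = double_coset G J x I"
proof
  show "double_coset G J y I \<subseteq> double_coset G J x I"
    using double_coset_mono assms by blast
  have c: "generate G J \<subseteq> carrier G" "generate G I \<subseteq> carrier G"
    using assms S generate_incl by auto
  obtain u v where uv: "u \<in> generate G J" "v \<in> generate G I" "y = u \<otimes> x \<otimes> v"
    using assms mem_double_coset by auto
  have "x = inv u \<otimes> y \<otimes> inv v"
    using uv c assms by (auto simp: m_assoc subset_iff) (metis inv_closed l_inv m_assoc l_one m_closed)
  moreover have "inv u \<in> generate G J" "inv v \<in> generate G I"
    using uv assms S generate_m_inv_closed by (meson subset_trans)+
  moreover have "y \<in> carrier G" using uv c assms by auto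
  ultimately have "x \<in> double_coset G J y I" "y \<in> carrier G"
    using assms mem_double_coset[of J I y x] by auto
  then show "double_coset G J x I \<subseteq> double_coset G J y I"
    using double_coset_mono assms by blast
qed

lemma is_dcoset_of_mem:
  assumes "is_dcoset G S J I p" "x \<in> elems p"
  shows "x \<in> carrier G" "p = DCoset J I (double_coset G J x I)"
proof -
  obtain y where y: "y \<in> carrier G" "p = DCoset J I (double_coset G J y I)" "J \<subseteq> S" "I \<subseteq> S"
    and f: "finitary G S J" "finitary G S I"
    using assms by (auto simp: is_dcoset_iff finitary_def)
  have x: "x \<in> double_coset G J y I" using assms y by simp
  then obtain u v where "u \<in> generate G J" "v \<in> generate G I" "x = u \<otimes> y \<otimes> v"
    using y mem_double_coset by auto
  then show "x \<in> carrier G" using f y generate_finitary_closed by auto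
  show "p = DCoset J I (double_coset G J x I)"
    using y x double_coset_eq by simp
qed

lemma is_dcoset_nonempty:
  assumes "is_dcoset G S J I p" shows "elems p \<noteq> {}"
proof -
  obtain x where "x \<in> carrier G" "p = DCoset J I (double_coset G J x I)" "J \<subseteq> S" "I \<subseteq> S"
    using assms unfolding is_dcoset_iff finitary_def by blast
  then show ?thesis using double_coset_self[of J I x] by auto
qed

lemma is_dcoset_finite:
  assumes "is_dcoset G S J I p" shows "finite (elems p)"
  using assms
  by (auto simp: is_dcoset_iff finitary_def double_coset_def set_mult_def l_coset_def)

lemma dcoset_containing_eqI:
  assumes "is_dcoset G S J I p" "A \<subseteq> elems p" "A \<noteq> {}"
  shows "dcoset_containing G S J I A = p"
  unfolding dcoset_containing_def
proof (rule the_equality)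
  obtain x where "x \<in> A" using assms by blast
  then show "q = p" if "is_dcoset G S J I q \<and> A \<subseteq> elems q" for q
    using that assms is_dcoset_of_mem(2) by (metis subsetD)
qed (use assms in blast)

lemma double_coset_one:
  assumes "I \<subseteq> S" shows "double_coset G I \<one> I = generate G I"
proof -
  have c: "generate G I \<subseteq> carrier G" using assms S generate_incl by auto
  show ?thesis
  proof (intro equalityI subsetI)
    fix y assume "y \<in> generate G I"
    then show "y \<in> double_coset G I \<one> I"
      using mem_double_coset[of I I \<one> y] assms c generate.one[of G I] by force
  next
    fix y assume "y \<in> double_coset G I \<one> I"
    then obtain u v where "u \<in> generate G I" "v \<in> generate G I" "y = u \<otimes> \<one> \<otimes> v"
      using mem_double_coset[of I I \<one> y] assms by auto
    then show "y \<in> generate G I" using c by (auto simp: subset_iff intro: generate.eng)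
  qed
qed

lemma is_dcoset_parabolic:
  assumes "finitary G S I" shows "is_dcoset G S I I (DCoset I I (generate G I))"
  using assms double_coset_one by (auto simp: is_dcoset_iff finitary_def intro!: bexI[of _ \<one>])

end

context coxeter
begin

lemmas dcoset_of_mem = is_dcoset_of_mem[OF is_group gens_subset]

lemma dcoset_gen_mult_closed:
  assumes "is_dcoset W S J I p" "x \<in> elems p"
  shows "s \<in> J \<Longrightarrow> s \<otimes> x \<in> elems p" "s \<in> I \<Longrightarrow> x \<otimes> s \<in> elems p"
proof -
  have sub: "J \<subseteq> S" "I \<subseteq> S" using is_dcoset_pair[OF assms(1)] by (auto simp: finitary_def)
  have xc: "x \<in> carrier W" and pe: "elems p = double_coset W J x I"
    using dcoset_of_mem[OF assms] by (metis, metis dcoset.sel(3))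
  have mem: "u \<otimes> x \<otimes> v \<in> elems p" if "u \<in> generate W J" "v \<in> generate W I" for u v
    using that mem_double_coset[OF is_group gens_subset sub xc] pe by blast
  show "s \<otimes> x \<in> elems p" if "s \<in> J"
  proof -
    have "s \<otimes> x \<otimes> \<one> \<in> elems p" using that by (intro mem generate.incl generate.one)
    then show ?thesis using that sub(1) xc by (simp add: subset_iff)
  qed
  show "x \<otimes> s \<in> elems p" if "s \<in> I"
  proof -
    have "\<one> \<otimes> x \<otimes> s \<in> elems p" using that by (intro mem generate.incl generate.one)
    then show ?thesis using that sub(2) xc by (simp add: subset_iff)
  qed
qed

text \<open>From any one of its elements, a double coset is exhausted by multiplying with the generators of
  the two parabolic subgroups on their respective sides.\<close>

lemma dcoset_induct:
  assumes p: "is_dcoset W S J I p" and x: "x \<in> elems p" and z: "z \<in> elems p"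
    and base: "P x"
    and left: "\<And>s y. s \<in> J \<Longrightarrow> y \<in> elems p \<Longrightarrow> P y \<Longrightarrow> P (s \<otimes> y)"
    and right: "\<And>s y. s \<in> I \<Longrightarrow> y \<in> elems p \<Longrightarrow> P y \<Longrightarrow> P (y \<otimes> s)"
  shows "P z"
proof -
  have sub: "J \<subseteq> S" "I \<subseteq> S" using is_dcoset_pair[OF p] by (auto simp: finitary_def)
  have xc: "x \<in> carrier W" and pe: "elems p = double_coset W J x I"
    using dcoset_of_mem[OF p x] by (metis, metis dcoset.sel(3))
  have lists: "v \<in> lists S" if "v \<in> lists I \<or> v \<in> lists J" for v
    using that sub by auto
  have 1: "x \<otimes> wp v \<in> elems p \<and> P (x \<otimes> wp v)" if "v \<in> lists I" for v
    using that
  proof (induction v rule: rev_induct)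
    case (snoc s v)
    then have sv: "s \<in> I" "v \<in> lists I" by auto
    then have "x \<otimes> wp (v @ [s]) = x \<otimes> wp v \<otimes> s"
      using sub(2) xc lists by (simp add: wp_append m_assoc subset_iff)
    then show ?case using snoc.IH sv right dcoset_gen_mult_closed[OF p] by simp
  qed (use x xc base in simp)
  have 2: "wp u \<otimes> (x \<otimes> wp v) \<in> elems p \<and> P (wp u \<otimes> (x \<otimes> wp v))"
    if "u \<in> lists J" "v \<in> lists I" for u v
    using that(1)
  proof (induction u rule: list.induct)
    case (Cons s u)
    then have su: "s \<in> J" "u \<in> lists J" by auto
    then have "u \<in> lists S" "v \<in> lists S" using lists that(2) by blast+
    then have "s \<in> carrier W" "wp u \<in> carrier W" "wp v \<in> carrier W"
      using sub(1) su(1) by (auto simp del: in_lists_conv_set)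
    then have "wp (s # u) \<otimes> (x \<otimes> wp v) = s \<otimes> (wp u \<otimes> (x \<otimes> wp v))"
      using xc by (simp add: m_assoc)
    then show ?case using Cons.IH su left dcoset_gen_mult_closed[OF p] by simp
  qed (use 1[OF that(2)] dcoset_of_mem(1)[OF p] in simp)
  have "\<exists>a\<in>generate W J. \<exists>b\<in>generate W I. z = a \<otimes> x \<otimes> b"
    using z pe mem_double_coset[OF is_group gens_subset sub xc] by blast
  then obtain u v where uv: "u \<in> lists J" "v \<in> lists I" "z = wp u \<otimes> x \<otimes> wp v"
    unfolding generate_words[OF sub(1)] generate_words[OF sub(2)] by blast
  then have "u \<in> lists S" "v \<in> lists S" using lists by blast+
  then have "wp u \<in> carrier W" "wp v \<in> carrier W" by simp_all
  then show ?thesis using 2[OF uv(1,2)] uv(3) xc by (simp add: m_assoc)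
qed

text \<open>A maximal element \<open>x\<close> dominates every \<open>s x\<close> and \<open>x s\<close> inside its double coset, since
  these are comparable with it. Lifting then spreads \<open>x \<preceq> x\<close> over the whole double coset.\<close>

lemma dcoset_maximal_greatest:
  assumes p: "is_dcoset W S J I p" and x: "x \<in> elems p"
    and max: "\<And>y. y \<in> elems p \<Longrightarrow> x \<preceq> y \<Longrightarrow> y = x" and z: "z \<in> elems p"
  shows "z \<preceq> x"
proof (rule dcoset_induct[OF p x z])
  have sub: "J \<subseteq> S" "I \<subseteq> S" using is_dcoset_pair[OF p] by (auto simp: finitary_def)
  have xc: "x \<in> carrier W" using dcoset_of_mem[OF p x] by metis
  have l: "s \<otimes> x \<preceq> x" if "s \<in> J" for s
  proof -
    have "s \<in> S" using that sub by blast
    then show ?thesis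
      using bruhat_comparable[OF xc] max[OF dcoset_gen_mult_closed(1)[OF p x that]]
        bruhat_le_refl[of W S x] by metis
  qed
  have r: "x \<otimes> s \<preceq> x" if "s \<in> I" for s
  proof -
    have "s \<in> S" using that sub by blast
    then show ?thesis
      using bruhat_comparable_right[OF xc] max[OF dcoset_gen_mult_closed(2)[OF p x that]]
        bruhat_le_refl[of W S x] by metis
  qed
  show "s \<otimes> y \<preceq> x" if "s \<in> J" "y \<in> elems p" "y \<preceq> x" for s y
    using that l sub dcoset_of_mem(1)[OF p] by - (rule lifting_below, auto)
  show "y \<otimes> s \<preceq> x" if "s \<in> I" "y \<in> elems p" "y \<preceq> x" for s y
    using that r sub xc dcoset_of_mem(1)[OF p] by - (rule lifting_below_right, auto)
qed simp

lemma dcoset_minimal_least: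
  assumes p: "is_dcoset W S J I p" and x: "x \<in> elems p"
    and min: "\<And>y. y \<in> elems p \<Longrightarrow> y \<preceq> x \<Longrightarrow> y = x" and z: "z \<in> elems p"
  shows "x \<preceq> z"
proof (rule dcoset_induct[OF p x z])
  have sub: "J \<subseteq> S" "I \<subseteq> S" using is_dcoset_pair[OF p] by (auto simp: finitary_def)
  have xc: "x \<in> carrier W" using dcoset_of_mem[OF p x] by metis
  have l: "x \<preceq> s \<otimes> x" if "s \<in> J" for s
  proof -
    have "s \<in> S" using that sub by blast
    then show ?thesis
      using bruhat_comparable[OF xc] min[OF dcoset_gen_mult_closed(1)[OF p x that]]
        bruhat_le_refl[of W S x] by metis
  qed
  have r: "x \<preceq> x \<otimes> s" if "s \<in> I" for s
  proof -
    have "s \<in> S" using that sub by blast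
    then show ?thesis
      using bruhat_comparable_right[OF xc] min[OF dcoset_gen_mult_closed(2)[OF p x that]]
        bruhat_le_refl[of W S x] by metis
  qed
  show "x \<preceq> s \<otimes> y" if "s \<in> J" "y \<in> elems p" "x \<preceq> y" for s y
    using that l sub by - (rule lifting_above, auto)
  show "x \<preceq> y \<otimes> s" if "s \<in> I" "y \<in> elems p" "x \<preceq> y" for s y
    using that r sub xc dcoset_of_mem(1)[OF p] by - (rule lifting_above_right, auto)
qed simp

text \<open>Bruhat relations strictly increase the length unless they are equalities, so an element of
  extremal length is Bruhat-extremal. Finiteness of the parabolic subgroups provides one of greatest length.\<close>

lemma dmax_greatest:
  assumes p: "is_dcoset W S J I p"
  shows "dmax W S p \<in> elems p" "z \<in> elems p \<Longrightarrow> z \<preceq> dmax W S p"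
proof -
  have fin: "finite (elems p)" and ne: "elems p \<noteq> {}"
    using is_dcoset_finite[OF is_group gens_subset p] is_dcoset_nonempty[OF is_group gens_subset p] by blast+
  obtain x where x: "x \<in> elems p" "\<And>y. y \<in> elems p \<Longrightarrow> len y \<le> len x"
  proof -
    have "Max (len ` elems p) \<in> len ` elems p" using fin ne by (intro Max_in) auto
    then obtain x where "x \<in> elems p" "len x = Max (len ` elems p)" by force
    then show thesis using that Max_ge[of "len ` elems p"] fin by simp
  qed
  have g: "z \<preceq> x" if "z \<in> elems p" for z
  proof (rule dcoset_maximal_greatest[OF p x(1) _ that])
    show "y = x" if "y \<in> elems p" "x \<preceq> y" for y
      using bruhat_le_length[OF that(2)] x(2)[OF that(1)] by auto
  qed
  then have "dmax W S p = x" using x by (intro dmax_eqI)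
  then show "dmax W S p \<in> elems p" "z \<in> elems p \<Longrightarrow> z \<preceq> dmax W S p" using x g by auto
qed

lemma dmin_least:
  assumes p: "is_dcoset W S J I p"
  shows "dmin W S p \<in> elems p" "z \<in> elems p \<Longrightarrow> dmin W S p \<preceq> z"
proof -
  have ne: "elems p \<noteq> {}"
    using is_dcoset_nonempty[OF is_group gens_subset p] .
  obtain x where x: "x \<in> elems p" "\<And>y. y \<in> elems p \<Longrightarrow> len x \<le> len y"
    using ne ex_has_least_nat[of "\<lambda>x. x \<in> elems p" _ len] by blast
  have g: "x \<preceq> z" if "z \<in> elems p" for z
  proof (rule dcoset_minimal_least[OF p x(1) _ that])
    show "y = x" if "y \<in> elems p" "y \<preceq> x" for y
      using bruhat_le_length[OF that(2)] x(2)[OF that(1)] by auto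
  qed
  then have "dmin W S p = x" using x by (intro dmin_eqI)
  then show "dmin W S p \<in> elems p" "z \<in> elems p \<Longrightarrow> dmin W S p \<preceq> z" using x g by auto
qed

lemma longest_greatest:
  assumes "finitary W S I"
  shows "longest W S I \<in> generate W I" "z \<in> generate W I \<Longrightarrow> z \<preceq> longest W S I"
proof -
  have p: "is_dcoset W S I I (DCoset I I (generate W I))"
    by (rule is_dcoset_parabolic[OF is_group gens_subset assms])
  have "longest W S I = dmax W S (DCoset I I (generate W I))"
    using dmax_greatest[OF p] by (intro longest_eqI) simp_all
  then show "longest W S I \<in> generate W I" "z \<in> generate W I \<Longrightarrow> z \<preceq> longest W S I"
    using dmax_greatest[OF p] by simp_all
qed

lemma len_one [simp]: "len \<one> = 0"
  using cox_length_le[of "[]" S W] by simp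

lemma one_least:
  assumes "finitary W S I" "z \<in> generate W I"
  shows "\<one> \<preceq> z"
proof -
  have p: "is_dcoset W S I I (DCoset I I (generate W I))"
    by (rule is_dcoset_parabolic[OF is_group gens_subset assms(1)])
  have "dmin W S (DCoset I I (generate W I)) \<preceq> \<one>"
    using dmin_least(2)[OF p] by (simp add: generate.one)
  then have "dmin W S (DCoset I I (generate W I)) = \<one>"
    using bruhat_le_length[of W S _ \<one>] by simp
  then show ?thesis using dmin_least(2)[OF p, of z] assms(2) by simp
qed

end


section \<open>Products of Coxeter groups\<close>

text \<open>Greatest and least elements of a product of double cosets are assembled from those of the factors,
  and the strict growth of length along the Bruhat order makes them unique. So the exchange property
  of the factors suffices.\<close>

locale coxeter_product = left: coxeter W S + right: coxeter W' S'
  for W :: "'a monoid" and S and W' :: "'b monoid" and S'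
begin

abbreviation P :: "('a \<times> 'b) monoid" where "P \<equiv> W \<times>\<times> W'"
abbreviation gu :: "'a set \<Rightarrow> 'b set \<Rightarrow> ('a \<times> 'b) set" where "gu \<equiv> gen_union W W'"
abbreviation T :: "('a \<times> 'b) set" where "T \<equiv> gu S S'"

lemma group_P: "group P"
  by (rule DirProd_group[OF left.is_group right.is_group])

lemma gens_subset_P: "T \<subseteq> carrier P"
  by (auto simp: gen_union_def in_left_def in_right_def)

lemma mem_gen_union:
  assumes "I \<subseteq> S"
  shows "(x, y) \<in> gu I J \<longleftrightarrow> x \<in> I \<and> y = \<one>\<^bsub>W'\<^esub> \<or> x = \<one>\<^bsub>W\<^esub> \<and> y \<in> J"
  by (auto simp: gen_union_def in_left_def in_right_def)

lemma gen_union_subset_iff: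
  assumes "I \<subseteq> S" "I' \<subseteq> S"
  shows "gu I J \<subseteq> gu I' J \<longleftrightarrow> I \<subseteq> I'"
proof
  assume sub: "gu I J \<subseteq> gu I' J"
  show "I \<subseteq> I'"
  proof
    fix s assume s: "s \<in> I"
    then have "(s, \<one>\<^bsub>W'\<^esub>) \<in> gu I' J" using sub assms mem_gen_union by blast
    moreover have "s \<noteq> \<one>\<^bsub>W\<^esub>" using s assms left.one_notin_gens by auto
    ultimately show "s \<in> I'" using mem_gen_union[OF assms(2)] by auto
  qed
qed (auto simp: gen_union_def)

lemma gen_union_eq_iff:
  assumes "I \<subseteq> S" "I' \<subseteq> S"
  shows "gu I J = gu I' J \<longleftrightarrow> I = I'"
  using gen_union_subset_iff assms by (metis subset_antisym order_refl)

lemma gen_union_psubset_iff: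
  assumes "I \<subseteq> S" "I' \<subseteq> S"
  shows "gu I J \<subset> gu I' J \<longleftrightarrow> I \<subset> I'"
  using gen_union_subset_iff assms by (metis psubset_eq gen_union_eq_iff)

lemma generate_gen_union:
  assumes "I \<subseteq> S" "J \<subseteq> S'"
  shows "generate P (gu I J) = generate W I \<times> generate W' J"
proof
  show "generate P (gu I J) \<subseteq> generate W I \<times> generate W' J"
  proof
    fix z assume "z \<in> generate P (gu I J)"
    then show "z \<in> generate W I \<times> generate W' J"
    proof induction
      case (inv h)
      then have "(\<exists>s\<in>I. h = (s, \<one>\<^bsub>W'\<^esub>)) \<or> (\<exists>t\<in>J. h = (\<one>\<^bsub>W\<^esub>, t))"
        by (auto simp: gen_union_def in_left_def in_right_def)
      then show ?case
        using assms by (auto simp: subset_iff inv_DirProd[OF left.is_group right.is_group]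
            intro: generate.intros)
    next
      case (eng g h)
      then show ?case by (auto intro: generate.eng)
    qed (auto simp: gen_union_def in_left_def in_right_def intro: generate.intros)
  qed
  have c: "generate W I \<subseteq> carrier W" "generate W' J \<subseteq> carrier W'"
    using assms left.gens_subset right.gens_subset left.generate_incl right.generate_incl
    by (meson subset_trans)+
  have l: "(x, \<one>\<^bsub>W'\<^esub>) \<in> generate P (gu I J)" if "x \<in> generate W I" for x
    using that
  proof induction
    case one
    then show ?case using generate.one[of P] by simp
  next
    case (incl h)
    then show ?case by (intro generate.incl) (auto simp: gen_union_def in_left_def)
  next
    case (inv h)
    then have "inv\<^bsub>W\<^esub> h = h" using assms by auto
    then show ?case using inv by (intro generate.incl) (auto simp: gen_union_def in_left_def)
  next
    case (eng g h)
    then show ?case using generate.eng[of "(g, \<one>\<^bsub>W'\<^esub>)" P _ "(h, \<one>\<^bsub>W'\<^esub>)"] by simp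
  qed
  have r: "(\<one>\<^bsub>W\<^esub>, y) \<in> generate P (gu I J)" if "y \<in> generate W' J" for y
    using that
  proof induction
    case one
    then show ?case using generate.one[of P] by simp
  next
    case (incl h)
    then show ?case by (intro generate.incl) (auto simp: gen_union_def in_right_def)
  next
    case (inv h)
    then have "inv\<^bsub>W'\<^esub> h = h" using assms by auto
    then show ?case using inv by (intro generate.incl) (auto simp: gen_union_def in_right_def)
  next
    case (eng g h)
    then show ?case using generate.eng[of "(\<one>\<^bsub>W\<^esub>, g)" P _ "(\<one>\<^bsub>W\<^esub>, h)"] by simp
  qed
  show "generate W I \<times> generate W' J \<subseteq> generate P (gu I J)"
  proof clarify
    fix x y assume xy: "x \<in> generate W I" "y \<in> generate W' J"
    then have "(x, y) = (x, \<one>\<^bsub>W'\<^esub>) \<otimes>\<^bsub>P\<^esub> (\<one>\<^bsub>W\<^esub>, y)"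
      using c by (auto simp: subset_iff)
    then show "(x, y) \<in> generate P (gu I J)"
      using generate.eng[OF l[OF xy(1)] r[OF xy(2)]] by simp
  qed
qed

lemma finitary_gen_union:
  assumes "finitary W S I" "finitary W' S' J"
  shows "finitary P T (gu I J)"
proof -
  have "gu I J \<subseteq> T" using assms unfolding finitary_def gen_union_def by blast
  then show ?thesis using assms by (simp add: finitary_def generate_gen_union)
qed

lemma word_projections:
  assumes "w \<in> lists T"
  shows "\<exists>u\<in>lists S. \<exists>v\<in>lists S'. word_prod P w = (word_prod W u, word_prod W' v) \<and>
    length w = length u + length v"
  using assms
proof (induction w rule: list.induct)
  case Nil
  then show ?case by (intro bexI[of _ "[]"]) auto
next
  case (Cons a w)
  then obtain u v where uv: "u \<in> lists S" "v \<in> lists S'"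
    "word_prod P w = (word_prod W u, word_prod W' v)" "length w = length u + length v"
    by auto
  have "a \<in> T" using Cons.prems by simp
  then consider s where "s \<in> S" "a = (s, \<one>\<^bsub>W'\<^esub>)" | t where "t \<in> S'" "a = (\<one>\<^bsub>W\<^esub>, t)"
    by (auto simp: gen_union_def in_left_def in_right_def)
  then show ?case
  proof cases
    case 1
    then show ?thesis using uv right.wp_closed[OF uv(2)] by (intro bexI[of _ "s # u"] bexI[of _ v]) auto
  next
    case 2
    then show ?thesis using uv left.wp_closed[OF uv(1)] by (intro bexI[of _ u] bexI[of _ "t # v"]) auto
  qed
qed

lemma word_prod_join:
  assumes "u \<in> lists S" "v \<in> lists S'"
  shows "word_prod P (map (in_left W') u @ map (in_right W) v) = (word_prod W u, word_prod W' v)"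
proof -
  have "word_prod P (map (in_right W) v) = (\<one>\<^bsub>W\<^esub>, word_prod W' v)"
    by (induction v) (auto simp: in_right_def)
  then show ?thesis
    using assms(1)
    by (induction u rule: list.induct) (use right.wp_closed[OF assms(2)] in \<open>auto simp: in_left_def\<close>)
qed

text \<open>The two kinds of generators commute, so reduced words of the components can be concatenated;
  conversely a word in the product is sorted into a word for each component.\<close>

lemma cox_length_prod:
  assumes "x \<in> carrier W" "y \<in> carrier W'"
  shows "cox_length P T (x, y) = left.len x + right.len y"
proof (rule antisym)
  obtain u where u: "u \<in> lists S" "word_prod W u = x" "length u = left.len x"
    using left.reduced_word[OF assms(1)] .
  obtain v where v: "v \<in> lists S'" "word_prod W' v = y" "length v = right.len y"
    using right.reduced_word[OF assms(2)] .
  let ?w = "map (in_left W') u @ map (in_right W) v"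
  have w: "?w \<in> lists T" "word_prod P ?w = (x, y)"
    using u v word_prod_join[OF u(1) v(1)] by (auto simp: gen_union_def)
  show "cox_length P T (x, y) \<le> left.len x + right.len y"
    using cox_length_le[OF w(1), of P] w u v by simp
  obtain w' where w': "w' \<in> lists T" "length w' = cox_length P T (x, y)" "word_prod P w' = (x, y)"
    using reduced_word_exists[OF w(1), of P] w(2) by auto
  obtain u' v' where "u' \<in> lists S" "v' \<in> lists S'" "word_prod W u' = x" "word_prod W' v' = y"
    "length w' = length u' + length v'"
    using word_projections[OF w'(1)] w'(3) by auto
  then show "left.len x + right.len y \<le> cox_length P T (x, y)"
    using cox_length_le[of u' S W] cox_length_le[of v' S' W'] w'(2) by simp
qed

lemma reflections_prod:
  "r \<in> reflections W S \<Longrightarrow> (r, \<one>\<^bsub>W'\<^esub>) \<in> reflections P T"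
  "r' \<in> reflections W' S' \<Longrightarrow> (\<one>\<^bsub>W\<^esub>, r') \<in> reflections P T"
proof -
  assume "r \<in> reflections W S"
  then obtain w s where w: "w \<in> carrier W" "s \<in> S" "r = w \<otimes>\<^bsub>W\<^esub> s \<otimes>\<^bsub>W\<^esub> inv\<^bsub>W\<^esub> w"
    unfolding reflections_def by blast
  then have "(r, \<one>\<^bsub>W'\<^esub>) = (w, \<one>\<^bsub>W'\<^esub>) \<otimes>\<^bsub>P\<^esub> (s, \<one>\<^bsub>W'\<^esub>) \<otimes>\<^bsub>P\<^esub> inv\<^bsub>P\<^esub> (w, \<one>\<^bsub>W'\<^esub>)"
    by (simp add: inv_DirProd[OF left.is_group right.is_group])
  moreover have "(w, \<one>\<^bsub>W'\<^esub>) \<in> carrier P" "(s, \<one>\<^bsub>W'\<^esub>) \<in> T"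
    using w by (auto simp: gen_union_def in_left_def)
  ultimately show "(r, \<one>\<^bsub>W'\<^esub>) \<in> reflections P T" unfolding reflections_def by blast
next
  assume "r' \<in> reflections W' S'"
  then obtain w s where w: "w \<in> carrier W'" "s \<in> S'" "r' = w \<otimes>\<^bsub>W'\<^esub> s \<otimes>\<^bsub>W'\<^esub> inv\<^bsub>W'\<^esub> w"
    unfolding reflections_def by blast
  then have "(\<one>\<^bsub>W\<^esub>, r') = (\<one>\<^bsub>W\<^esub>, w) \<otimes>\<^bsub>P\<^esub> (\<one>\<^bsub>W\<^esub>, s) \<otimes>\<^bsub>P\<^esub> inv\<^bsub>P\<^esub> (\<one>\<^bsub>W\<^esub>, w)"
    by (simp add: inv_DirProd[OF left.is_group right.is_group])
  moreover have "(\<one>\<^bsub>W\<^esub>, w) \<in> carrier P" "(\<one>\<^bsub>W\<^esub>, s) \<in> T"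
    using w by (auto simp: gen_union_def in_right_def)
  ultimately show "(\<one>\<^bsub>W\<^esub>, r') \<in> reflections P T" unfolding reflections_def by blast
qed

lemma bruhat_step_left:
  assumes "bruhat_step W S a b" "y \<in> carrier W'"
  shows "bruhat_step P T (a, y) (b, y)"
proof -
  obtain r where r: "a \<in> carrier W" "r \<in> reflections W S" "b = a \<otimes>\<^bsub>W\<^esub> r" "left.len a < left.len b"
    using assms by (auto simp: bruhat_step_def)
  then have "(b, y) = (a, y) \<otimes>\<^bsub>P\<^esub> (r, \<one>\<^bsub>W'\<^esub>)" using assms by simp
  moreover have "cox_length P T (a, y) < cox_length P T (b, y)"
    using r assms by (simp add: cox_length_prod)
  moreover have "(a, y) \<in> carrier P" using r assms by simp
  ultimately show ?thesis using reflections_prod(1)[OF r(2)] unfolding bruhat_step_def by blast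
qed

lemma bruhat_step_right:
  assumes "bruhat_step W' S' a b" "x \<in> carrier W"
  shows "bruhat_step P T (x, a) (x, b)"
proof -
  obtain r where r: "a \<in> carrier W'" "r \<in> reflections W' S'" "b = a \<otimes>\<^bsub>W'\<^esub> r" "right.len a < right.len b"
    using assms by (auto simp: bruhat_step_def)
  then have "(x, b) = (x, a) \<otimes>\<^bsub>P\<^esub> (\<one>\<^bsub>W\<^esub>, r)" using assms by simp
  moreover have "cox_length P T (x, a) < cox_length P T (x, b)"
    using r assms by (simp add: cox_length_prod)
  moreover have "(x, a) \<in> carrier P" using r assms by simp
  ultimately show ?thesis using reflections_prod(2)[OF r(2)] unfolding bruhat_step_def by blast
qed

lemma bruhat_le_prod:
  assumes "bruhat_le W S a b" "bruhat_le W' S' c d" "b \<in> carrier W" "c \<in> carrier W'"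
  shows "bruhat_le P T (a, c) (b, d)"
proof -
  have "bruhat_le P T (a, c) (b, c)"
    using assms(1)[unfolded bruhat_le_steps]
  proof (induction rule: rtranclp_induct)
    case (step x y)
    from bruhat_step_le[OF bruhat_step_left[OF step(2) assms(4)]] step.IH show ?case
      by (blast intro: bruhat_le_trans)
  qed simp
  moreover have "bruhat_le P T (b, c) (b, d)"
    using assms(2)[unfolded bruhat_le_steps]
  proof (induction rule: rtranclp_induct)
    case (step x y)
    from bruhat_step_le[OF bruhat_step_right[OF step(2) assms(3)]] step.IH show ?case
      by (blast intro: bruhat_le_trans)
  qed simp
  ultimately show ?thesis by (rule bruhat_le_trans)
qed

lemma longest_prod:
  assumes "finitary W S I" "finitary W' S' J"
  shows "longest P T (gu I J) = (longest W S I, longest W' S' J)"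
proof (rule longest_eqI)
  have g: "generate P (gu I J) = generate W I \<times> generate W' J"
    using assms by (intro generate_gen_union) (auto simp: finitary_def)
  show "(longest W S I, longest W' S' J) \<in> generate P (gu I J)"
    using left.longest_greatest(1) right.longest_greatest(1) assms g by simp
  show "bruhat_le P T z (longest W S I, longest W' S' J)" if "z \<in> generate P (gu I J)" for z
  proof (cases z)
    case (Pair x y)
    then have xy: "x \<in> generate W I" "y \<in> generate W' J" using that g by auto
    have "longest W S I \<in> carrier W" "y \<in> carrier W'"
      using left.longest_greatest(1)[OF assms(1)] xy
        generate_finitary_closed[OF left.is_group left.gens_subset assms(1)]
        generate_finitary_closed[OF right.is_group right.gens_subset assms(2)] by auto
    with xy show ?thesis
      using left.longest_greatest(2)[OF assms(1)] right.longest_greatest(2)[OF assms(2)] Pair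
      by (simp add: bruhat_le_prod)
  qed
qed

lemma par_length_prod:
  assumes "finitary W S I" "finitary W' S' J"
  shows "par_length P T (gu I J) = par_length W S I + par_length W' S' J"
proof -
  have "longest W S I \<in> carrier W" "longest W' S' J \<in> carrier W'"
    using left.longest_greatest(1)[OF assms(1)] right.longest_greatest(1)[OF assms(2)]
      generate_finitary_closed[OF left.is_group left.gens_subset assms(1)]
      generate_finitary_closed[OF right.is_group right.gens_subset assms(2)] by auto
  then show ?thesis using assms by (simp add: par_length_def longest_prod cox_length_prod)
qed

text \<open>The coset \<open>p\<^sup>(\<^sup>+\<^sup>J\<^sup>)\<close> in explicit form. No representative is mentioned, which makes it
  visibly injective in \<open>p\<close> and compatible with inclusions between double cosets.\<close>

definition plus_dcoset :: "'b set \<Rightarrow> 'a dcoset \<Rightarrow> ('a \<times> 'b) dcoset" where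
  "plus_dcoset J p =
    DCoset (gu (dleft p) J) (gu (dright p) J) (elems p \<times> generate W' J)"

lemma is_dcoset_plus:
  assumes p: "is_dcoset W S K I p" and J: "finitary W' S' J"
  shows "is_dcoset P T (gu K J) (gu I J) (plus_dcoset J p)"
proof -
  obtain x where x: "x \<in> carrier W" "p = DCoset K I (double_coset W K x I)"
    and f: "finitary W S K" "finitary W S I"
    using p unfolding is_dcoset_iff by blast
  have sub: "K \<subseteq> S" "I \<subseteq> S" "J \<subseteq> S'" using f J by (auto simp: finitary_def)
  have subP: "gu K J \<subseteq> T" "gu I J \<subseteq> T" using sub by (auto simp: gen_union_def)
  have xP: "(x, \<one>\<^bsub>W'\<^esub>) \<in> carrier P" using x by simp
  note memW = mem_double_coset[OF left.is_group left.gens_subset sub(1,2) x(1)]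
  note memW' = mem_double_coset[OF right.is_group right.gens_subset sub(3) sub(3) right.one_closed]
  note memP = mem_double_coset[OF group_P gens_subset_P subP xP]
  have "double_coset P (gu K J) (x, \<one>\<^bsub>W'\<^esub>) (gu I J)
      = double_coset W K x I \<times> double_coset W' J \<one>\<^bsub>W'\<^esub> J"
  proof (rule Set.set_eqI)
    fix z show "z \<in> double_coset P (gu K J) (x, \<one>\<^bsub>W'\<^esub>) (gu I J) \<longleftrightarrow>
        z \<in> double_coset W K x I \<times> double_coset W' J \<one>\<^bsub>W'\<^esub> J"
    proof (cases z)
      case (Pair a b)
      show ?thesis
        unfolding Pair mem_Times_iff fst_conv snd_conv memP memW memW'
          generate_gen_union[OF sub(1,3)] generate_gen_union[OF sub(2,3)]
        by auto
    qed
  qed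
  then have "plus_dcoset J p = DCoset (gu K J) (gu I J)
      (double_coset P (gu K J) (x, \<one>\<^bsub>W'\<^esub>) (gu I J))"
    using x double_coset_one[OF right.is_group right.gens_subset sub(3)]
    by (simp add: plus_dcoset_def)
  then show ?thesis
    using xP finitary_gen_union[OF f(1) J] finitary_gen_union[OF f(2) J]
    unfolding is_dcoset_iff by blast
qed

lemma extremal_plus:
  assumes p: "is_dcoset W S K I p" and J: "finitary W' S' J"
  shows "dmax P T (plus_dcoset J p) = (dmax W S p, longest W' S' J)"
    and "dmin P T (plus_dcoset J p) = (dmin W S p, \<one>\<^bsub>W'\<^esub>)"
proof -
  have e: "elems (plus_dcoset J p) = elems p \<times> generate W' J" by (simp add: plus_dcoset_def)
  have cW: "x \<in> carrier W" if "x \<in> elems p" for x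
    using left.dcoset_of_mem(1)[OF p that] .
  have cW': "y \<in> carrier W'" if "y \<in> generate W' J" for y
    using generate_finitary_closed[OF right.is_group right.gens_subset J that] .
  show "dmax P T (plus_dcoset J p) = (dmax W S p, longest W' S' J)"
  proof (rule dmax_eqI)
    show "bruhat_le P T z (dmax W S p, longest W' S' J)" if "z \<in> elems (plus_dcoset J p)" for z
      using that left.dmax_greatest[OF p] right.longest_greatest[OF J] cW cW'
      unfolding e by (auto intro!: bruhat_le_prod)
  qed (use e left.dmax_greatest[OF p] right.longest_greatest[OF J] in simp)
  show "dmin P T (plus_dcoset J p) = (dmin W S p, \<one>\<^bsub>W'\<^esub>)"
  proof (rule dmin_eqI)
    show "bruhat_le P T (dmin W S p, \<one>\<^bsub>W'\<^esub>) z" if "z \<in> elems (plus_dcoset J p)" for z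
      using that left.dmin_least[OF p] right.one_least[OF J] cW cW'
      unfolding e by (auto intro!: bruhat_le_prod)
  qed (use e left.dmin_least[OF p] generate.one[of W' J] in simp)
qed

lemma dcoset_plus_eq:
  assumes p: "is_dcoset W S K I p" and J: "finitary W' S' J"
  shows "dcoset_plus W S W' S' p J = plus_dcoset J p"
proof -
  have x: "dmax W S p \<in> elems p" "dmax W S p \<in> carrier W"
    using left.dmax_greatest(1)[OF p] left.dcoset_of_mem(1)[OF p] by auto
  have y: "longest W' S' J \<in> generate W' J" "longest W' S' J \<in> carrier W'"
    using right.longest_greatest(1)[OF J]
      generate_finitary_closed[OF right.is_group right.gens_subset J] by auto
  have "in_left W' (dmax W S p) \<otimes>\<^bsub>P\<^esub> in_right W (longest W' S' J)
      = (dmax W S p, longest W' S' J)"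
    using x y by (simp add: in_left_def in_right_def)
  then show ?thesis
    unfolding dcoset_plus_def is_dcoset_pair(1,2)[OF p]
    using x y
    by (intro dcoset_containing_eqI[OF group_P gens_subset_P is_dcoset_plus[OF p J]])
      (simp_all add: plus_dcoset_def)
qed

text \<open>Conjugation by \<open>(min p, e)\<close> fixes \<open>J\<close> pointwise, so \<open>J\<close> is entirely redundant. The two halves of
  the union do not interact because the identity is not a generator.\<close>

lemma left_redundancy_plus:
  assumes p: "is_dcoset W S K I p" and J: "finitary W' S' J"
  shows "left_redundancy P T (plus_dcoset J p) = gu (left_redundancy W S p) J"
proof -
  let ?x = "dmin W S p"
  have x: "?x \<in> carrier W" using left.dmin_least(1)[OF p] left.dcoset_of_mem(1)[OF p] by auto
  have sub: "K \<subseteq> S" "I \<subseteq> S" "J \<subseteq> S'"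
    using is_dcoset_pair[OF p] J by (auto simp: finitary_def)
  have "conj_set P (?x, \<one>\<^bsub>W'\<^esub>) (gu I J) = gu (conj_set W ?x I) J"
  proof -
    have "(?x, \<one>\<^bsub>W'\<^esub>) \<otimes>\<^bsub>P\<^esub> in_left W' s \<otimes>\<^bsub>P\<^esub> inv\<^bsub>P\<^esub> (?x, \<one>\<^bsub>W'\<^esub>)
        = in_left W' (?x \<otimes>\<^bsub>W\<^esub> s \<otimes>\<^bsub>W\<^esub> inv\<^bsub>W\<^esub> ?x)" for s
      using x by (simp add: in_left_def inv_DirProd[OF left.is_group right.is_group])
    moreover have "(?x, \<one>\<^bsub>W'\<^esub>) \<otimes>\<^bsub>P\<^esub> in_right W t \<otimes>\<^bsub>P\<^esub> inv\<^bsub>P\<^esub> (?x, \<one>\<^bsub>W'\<^esub>) = in_right W t"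
      if "t \<in> J" for t
      using x that sub by (auto simp: in_right_def inv_DirProd[OF left.is_group right.is_group])
    ultimately show ?thesis
      unfolding conj_set_def gen_union_def image_Un image_image by (simp cong: image_cong)
  qed
  moreover have "gu K J \<inter> gu A J = gu (K \<inter> A) J" for A
    using sub left.one_notin_gens right.one_notin_gens
    by (auto simp: gen_union_def in_left_def in_right_def)
  ultimately show ?thesis
    unfolding left_redundancy_def extremal_plus(2)[OF p J]
    using is_dcoset_pair[OF p] by (simp add: plus_dcoset_def)
qed

lemma finitary_left_redundancy:
  assumes p: "is_dcoset W S K I p"
  shows "finitary W S (left_redundancy W S p)"
proof -
  have "left_redundancy W S p \<subseteq> K" using is_dcoset_pair[OF p] by (auto simp: left_redundancy_def)
  moreover have "generate W (left_redundancy W S p) \<subseteq> generate W K"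
    by (rule left.mono_generate) fact
  ultimately show ?thesis
    using is_dcoset_pair(3)[OF p] unfolding finitary_def by (blast intro: finite_subset)
qed

text \<open>In \<open>\<ell>\<^sup>+\<close> the length of \<open>w\<^sub>J\<close> enters through the maximal element and is subtracted with
  the left parabolic; in \<open>\<ell>\<^sup>-\<close> it enters with the left parabolic and is subtracted with the
  redundancy.\<close>

lemma dlen_plus_dcoset:
  assumes p: "is_dcoset W S K I p" and J: "finitary W' S' J"
  shows "dlen_plus P T (plus_dcoset J p) = dlen_plus W S p"
    and "dlen_minus P T (plus_dcoset J p) = dlen_minus W S p"
proof -
  have f: "finitary W S K" "dleft p = K" "dleft (plus_dcoset J p) = gu K J"
    using is_dcoset_pair[OF p] by (auto simp: plus_dcoset_def)
  have c: "dmax W S p \<in> carrier W" "dmin W S p \<in> carrier W" "longest W' S' J \<in> carrier W'"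
    using left.dmin_least(1)[OF p] left.dmax_greatest(1)[OF p] left.dcoset_of_mem(1)[OF p]
      right.longest_greatest(1)[OF J]
      generate_finitary_closed[OF right.is_group right.gens_subset J] by auto
  show "dlen_plus P T (plus_dcoset J p) = dlen_plus W S p"
    unfolding dlen_plus_def extremal_plus(1)[OF p J] f
    using c by (simp add: cox_length_prod par_length_prod[OF f(1) J]) (simp add: par_length_def)
  show "dlen_minus P T (plus_dcoset J p) = dlen_minus W S p"
    unfolding dlen_minus_def extremal_plus(2)[OF p J] f left_redundancy_plus[OF p J]
    using c by (simp add: cox_length_prod par_length_prod[OF f(1) J]
        par_length_prod[OF finitary_left_redundancy[OF p] J])
qed

lemma plus_dcoset_inj:
  assumes "is_dcoset W S K I p" "is_dcoset W S K I q" "plus_dcoset J p = plus_dcoset J q"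
  shows "p = q"
proof -
  have "elems p \<times> generate W' J = elems q \<times> generate W' J"
    using assms(3) by (simp add: plus_dcoset_def)
  then have "elems p = elems q"
    using generate.one[of W' J] by (auto simp: times_eq_iff)
  then show ?thesis
    using is_dcoset_pair[OF assms(1)] is_dcoset_pair[OF assms(2)] by (simp add: dcoset.expand)
qed

section \<open>Singular expressions in a product\<close>

lemma expr_plus_nth [simp]: "i < length Is \<Longrightarrow> expr_plus W W' Is J ! i = gu (Is ! i) J"
  by (simp add: expr_plus_def)

lemma expr_plus_length [simp]: "length (expr_plus W W' Is J) = length Is"
  by (simp add: expr_plus_def)

lemma expression_finitary:
  "is_expression W S Is \<Longrightarrow> i < length Is \<Longrightarrow> finitary W S (Is ! i)"
  by (simp add: is_expression_def)

lemma expression_subset: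
  "is_expression W S Is \<Longrightarrow> i < length Is \<Longrightarrow> Is ! i \<subseteq> S"
  using expression_finitary by (simp add: finitary_def)

lemma is_expression_plus:
  assumes Is: "is_expression W S Is" and J: "finitary W' S' J"
  shows "is_expression P T (expr_plus W W' Is J)"
  unfolding is_expression_def
proof (intro conjI ballI allI impI)
  show "expr_plus W W' Is J \<noteq> []" using Is by (simp add: is_expression_def expr_plus_def)
  show "finitary P T I" if "I \<in> set (expr_plus W W' Is J)" for I
    using that Is J finitary_gen_union by (auto simp: is_expression_def expr_plus_def)
  fix i assume "Suc i < length (expr_plus W W' Is J)"
  then have i: "Suc i < length Is" by simp
  then obtain s where s: "s \<in> S"
    "s \<notin> Is ! i \<and> Is ! Suc i = insert s (Is ! i) \<or> s \<notin> Is ! Suc i \<and> Is ! i = insert s (Is ! Suc i)"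
    using Is unfolding is_expression_def by blast
  have ins: "gu (insert s I) J = insert (in_left W' s) (gu I J)" for I
    by (simp add: gen_union_def)
  have notin: "in_left W' s \<notin> gu I J" if "s \<notin> I" for I
    using that s(1) left.one_notin_gens by (auto simp: gen_union_def in_left_def in_right_def)
  have "in_left W' s \<in> T" using s(1) by (simp add: gen_union_def)
  then show "\<exists>s\<in>T. s \<notin> expr_plus W W' Is J ! i \<and>
        expr_plus W W' Is J ! Suc i = insert s (expr_plus W W' Is J ! i) \<or>
      s \<notin> expr_plus W W' Is J ! Suc i \<and>
        expr_plus W W' Is J ! i = insert s (expr_plus W W' Is J ! Suc i)"
    using i s(2) ins notin by (intro bexI[of _ "in_left W' s"]) auto
qed

text \<open>Each step of a forward path takes the double coset of a given nonempty set. In the product this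
  set is contained in the old set times \<open>W'\<^sub>J\<close>, so the coset found is the old one times \<open>W'\<^sub>J\<close>.\<close>

lemma forward_path_plus:
  assumes Is: "is_expression W S Is" and J: "finitary W' S' J" and i: "i < length Is"
  shows "is_dcoset W S (Is ! 0) (Is ! i) (forward_path W S Is i) \<and>
    forward_path P T (expr_plus W W' Is J) i = plus_dcoset J (forward_path W S Is i)"
  using i
proof (induction i)
  case 0
  have f: "finitary W S (Is ! 0)" using expression_finitary[OF Is 0] .
  define q where "q = DCoset (Is ! 0) (Is ! 0) (generate W (Is ! 0))"
  have q: "is_dcoset W S (Is ! 0) (Is ! 0) q"
    unfolding q_def by (rule is_dcoset_parabolic[OF left.is_group left.gens_subset f])
  have "forward_path W S Is 0 = q"
    unfolding forward_path.simps
    by (rule dcoset_containing_eqI[OF left.is_group left.gens_subset q])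
      (simp_all add: q_def generate.one)
  moreover have "forward_path P T (expr_plus W W' Is J) 0 = plus_dcoset J q"
    unfolding forward_path.simps expr_plus_nth[OF 0]
    by (rule dcoset_containing_eqI[OF group_P gens_subset_P is_dcoset_plus[OF q J]])
      (simp_all add: q_def plus_dcoset_def generate.one)
  ultimately show ?case using q by simp
next
  case (Suc i)
  let ?p = "forward_path W S Is i" and ?K = "Is ! 0" and ?I = "Is ! i" and ?I' = "Is ! Suc i"
  have p: "is_dcoset W S ?K ?I ?p"
    and pP: "forward_path P T (expr_plus W W' Is J) i = plus_dcoset J ?p"
    using Suc by auto
  have n: "0 < length Is" "i < length Is" using Suc.prems by auto
  note f = expression_finitary[OF Is n(1)] expression_finitary[OF Is Suc.prems]
  note sub = expression_subset[OF Is n(1)] expression_subset[OF Is n(2)]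
    expression_subset[OF Is Suc.prems]
  have x: "dmax W S ?p \<in> elems ?p" "dmax W S ?p \<in> carrier W"
    using left.dmax_greatest(1)[OF p] left.dcoset_of_mem(1)[OF p] by auto
  define A where "A = (if ?I \<subset> ?I' then elems ?p else {dmax W S ?p})"
  define q where "q = DCoset ?K ?I' (double_coset W ?K (dmax W S ?p) ?I')"
  have q: "is_dcoset W S ?K ?I' q"
    using f x unfolding q_def is_dcoset_iff by blast
  have xq: "dmax W S ?p \<in> double_coset W ?K (dmax W S ?p) ?I'"
    by (rule double_coset_self[OF left.is_group left.gens_subset sub(1,3) x(2)])
  have Aq: "A \<subseteq> elems q" "A \<noteq> {}"
  proof -
    have "elems ?p \<subseteq> elems q" if "?I \<subset> ?I'"
    proof -
      have "elems ?p = double_coset W ?K (dmax W S ?p) ?I"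
        using left.dcoset_of_mem(2)[OF p x(1)] by (metis dcoset.sel(3))
      also have "\<dots> \<subseteq> double_coset W ?K (dmax W S ?p) ?I'"
        using that xq x(2) sub
        by (intro double_coset_mono[OF left.is_group left.gens_subset]) auto
      finally show ?thesis by (simp add: q_def)
    qed
    then show "A \<subseteq> elems q" "A \<noteq> {}" using x xq by (auto simp: A_def q_def)
  qed
  have "forward_path W S Is (Suc i) = q"
    unfolding forward_path.simps A_def[symmetric]
    by (rule dcoset_containing_eqI[OF left.is_group left.gens_subset q Aq])
  moreover have "forward_path P T (expr_plus W W' Is J) (Suc i) = plus_dcoset J q"
  proof -
    define B where "B = (if gu ?I J \<subset> gu ?I' J then elems (plus_dcoset J ?p)
      else {dmax P T (plus_dcoset J ?p)})"
    have y: "longest W' S' J \<in> generate W' J" using right.longest_greatest(1)[OF J] .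
    have "B \<subseteq> A \<times> generate W' J" "B \<noteq> {}"
      using x y generate.one[of W' J]
      unfolding B_def A_def gen_union_psubset_iff[OF sub(2,3)] extremal_plus(1)[OF p J]
      by (auto simp: plus_dcoset_def)
    then have B: "B \<subseteq> elems (plus_dcoset J q)" "B \<noteq> {}"
      using Aq(1) by (auto simp: plus_dcoset_def)
    show ?thesis
      unfolding forward_path.simps pP expr_plus_nth[OF Suc.prems] expr_plus_nth[OF n(1)]
        expr_plus_nth[OF n(2)] B_def[symmetric]
      by (rule dcoset_containing_eqI[OF group_P gens_subset_P is_dcoset_plus[OF q J] B])
  qed
  ultimately show ?case using q by simp
qed

lemma elen_plus_expr:
  assumes Is: "is_expression W S Is" and J: "finitary W' S' J"
  shows "elen_plus P T (expr_plus W W' Is J) = elen_plus W S Is"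
    and "elen_minus P T (expr_plus W W' Is J) = elen_minus W S Is"
proof -
  have len: "par_length P T (expr_plus W W' Is J ! i) = par_length W S (Is ! i) + par_length W' S' J"
    if "i < length Is" for i
    using that par_length_prod[OF expression_finitary[OF Is that] J] by simp
  have sub: "expr_plus W W' Is J ! i \<subset> expr_plus W W' Is J ! k \<longleftrightarrow> Is ! i \<subset> Is ! k"
    if "i < length Is" "k < length Is" for i k
    using that gen_union_psubset_iff expression_subset[OF Is] by simp
  show "elen_plus P T (expr_plus W W' Is J) = elen_plus W S Is"
    unfolding elen_plus_def expr_plus_length
  proof (rule sum.cong)
    show "{i. 1 \<le> i \<and> i < length Is \<and> expr_plus W W' Is J ! (i - 1) \<subset> expr_plus W W' Is J ! i}
        = {i. 1 \<le> i \<and> i < length Is \<and> Is ! (i - 1) \<subset> Is ! i}"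
      by (rule Collect_cong) (metis sub less_imp_diff_less)
  qed (simp del: expr_plus_nth add: len less_imp_diff_less)
  show "elen_minus P T (expr_plus W W' Is J) = elen_minus W S Is"
    unfolding elen_minus_def expr_plus_length
  proof (rule sum.cong)
    show "{i. 1 \<le> i \<and> i < length Is \<and> expr_plus W W' Is J ! i \<subset> expr_plus W W' Is J ! (i - 1)}
        = {i. 1 \<le> i \<and> i < length Is \<and> Is ! i \<subset> Is ! (i - 1)}"
      by (rule Collect_cong) (metis sub less_imp_diff_less)
  qed (simp del: expr_plus_nth add: len less_imp_diff_less)
qed

lemma expresses_plus_iff:
  assumes Is: "is_expression W S Is" and J: "finitary W' S' J"
    and p: "is_dcoset W S (hd Is) (last Is) p"
  shows "expresses P T (expr_plus W W' Is J) (plus_dcoset J p) \<longleftrightarrow> expresses W S Is p"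
proof -
  have ne: "Is \<noteq> []" using Is by (simp add: is_expression_def)
  then have n: "length Is - 1 < length Is" by simp
  have "is_dcoset W S (Is ! 0) (Is ! (length Is - 1)) p"
    using p ne by (simp add: hd_conv_nth last_conv_nth)
  then show ?thesis
    using forward_path_plus[OF Is J n] plus_dcoset_inj Is is_expression_plus[OF Is J]
    unfolding expresses_def expr_plus_length by metis
qed

lemma reduced_expression_plus_iff:
  assumes Is: "is_expression W S Is" and J: "finitary W' S' J"
  shows "reduced_expression P T (expr_plus W W' Is J) \<longleftrightarrow> reduced_expression W S Is"
proof -
  have "(dmin P T (forward_path P T (expr_plus W W' Is J) i) =
         dmin P T (forward_path P T (expr_plus W W' Is J) (Suc i)) \<and>
       left_redundancy P T (forward_path P T (expr_plus W W' Is J) i) =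
         left_redundancy P T (forward_path P T (expr_plus W W' Is J) (Suc i))) \<longleftrightarrow>
      (dmin W S (forward_path W S Is i) = dmin W S (forward_path W S Is (Suc i)) \<and>
       left_redundancy W S (forward_path W S Is i) =
         left_redundancy W S (forward_path W S Is (Suc i)))"
    and "expr_plus W W' Is J ! i \<subset> expr_plus W W' Is J ! Suc i \<longleftrightarrow> Is ! i \<subset> Is ! Suc i"
    if i: "Suc i < length Is" for i
  proof -
    have i': "i < length Is" using i by simp
    note a = forward_path_plus[OF Is J i', THEN conjunct1]
      forward_path_plus[OF Is J i, THEN conjunct1]
    note b = forward_path_plus[OF Is J i', THEN conjunct2]
      forward_path_plus[OF Is J i, THEN conjunct2]
    have sub: "left_redundancy W S (forward_path W S Is k) \<subseteq> S"
      if "k < length Is" for k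
      using finitary_left_redundancy forward_path_plus[OF Is J that] by (auto simp: finitary_def)
    show "(dmin P T (forward_path P T (expr_plus W W' Is J) i) =
         dmin P T (forward_path P T (expr_plus W W' Is J) (Suc i)) \<and>
       left_redundancy P T (forward_path P T (expr_plus W W' Is J) i) =
         left_redundancy P T (forward_path P T (expr_plus W W' Is J) (Suc i))) \<longleftrightarrow>
      (dmin W S (forward_path W S Is i) = dmin W S (forward_path W S Is (Suc i)) \<and>
       left_redundancy W S (forward_path W S Is i) =
         left_redundancy W S (forward_path W S Is (Suc i)))"
      unfolding b extremal_plus(2)[OF a(1) J] extremal_plus(2)[OF a(2) J]
        left_redundancy_plus[OF a(1) J] left_redundancy_plus[OF a(2) J]
        gen_union_eq_iff[OF sub[OF i'] sub[OF i]] by simp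
    show "expr_plus W W' Is J ! i \<subset> expr_plus W W' Is J ! Suc i \<longleftrightarrow> Is ! i \<subset> Is ! Suc i"
      using i gen_union_psubset_iff expression_subset[OF Is] by simp
  qed
  then show ?thesis
    using Is is_expression_plus[OF Is J] unfolding reduced_expression_def expr_plus_length by metis
qed

end

theorem proposition4p30:
  fixes W :: "'a monoid" and S :: "'a set"
    and W' :: "'b monoid" and S' :: "'b set"
    and Is :: "'a set list" and p :: "'a dcoset" and J :: "'b set"
  assumes "coxeter_system W S" and "coxeter_system W' S'"
    and "is_expression W S Is"
    and "is_dcoset W S (hd Is) (last Is) p"
    and "finitary W' S' J"
  shows
    "(reduced_product (W \<times>\<times> W') (gen_union W W' S S')
        (dmax (W \<times>\<times> W') (gen_union W W' S S') (dcoset_plus W S W' S' p J))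
        (in_left W' (dmax W S p)) (in_right W (longest W' S' J)) \<and>
      dmin (W \<times>\<times> W') (gen_union W W' S S') (dcoset_plus W S W' S' p J) =
        in_left W' (dmin W S p)) \<and>
     (dlen_plus (W \<times>\<times> W') (gen_union W W' S S') (dcoset_plus W S W' S' p J) =
        dlen_plus W S p \<and>
      dlen_minus (W \<times>\<times> W') (gen_union W W' S S') (dcoset_plus W S W' S' p J) =
        dlen_minus W S p) \<and>
     (elen_plus (W \<times>\<times> W') (gen_union W W' S S') (expr_plus W W' Is J) =
        elen_plus W S Is \<and>
      elen_minus (W \<times>\<times> W') (gen_union W W' S S') (expr_plus W W' Is J) =
        elen_minus W S Is) \<and>
     (expresses W S Is p \<longleftrightarrow>
        expresses (W \<times>\<times> W') (gen_union W W' S S')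
          (expr_plus W W' Is J) (dcoset_plus W S W' S' p J)) \<and>
     (reduced_expression W S Is \<longleftrightarrow>
        reduced_expression (W \<times>\<times> W') (gen_union W W' S S') (expr_plus W W' Is J))"
proof -
  interpret coxeter_product W S W' S'
    using assms(1,2)
    by (intro coxeter_product.intro coxeter.intro coxeter_axioms.intro) (auto simp: coxeter_system_def)
  note p = assms(4) and J = assms(5)
  have c: "dmax W S p \<in> carrier W" "longest W' S' J \<in> carrier W'"
    using left.dmax_greatest(1)[OF p] left.dcoset_of_mem(1)[OF p] right.longest_greatest(1)[OF J]
      generate_finitary_closed[OF right.is_group right.gens_subset J] by auto
  have "reduced_product P T (dmax P T (plus_dcoset J p))
      (in_left W' (dmax W S p)) (in_right W (longest W' S' J))"
    using c unfolding extremal_plus(1)[OF p J] reduced_product_def in_left_def in_right_def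
    by (simp add: cox_length_prod)
  moreover have "dmin P T (plus_dcoset J p) = in_left W' (dmin W S p)"
    unfolding extremal_plus(2)[OF p J] in_left_def ..
  ultimately show ?thesis
    unfolding dcoset_plus_eq[OF p J]
    using dlen_plus_dcoset[OF p J] elen_plus_expr[OF assms(3) J]
      expresses_plus_iff[OF assms(3) J p] reduced_expression_plus_iff[OF assms(3) J]
    by blast
qed

end
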